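(* Let $\mathcal{G}$ be a finite-dimensional complex Lie algebra equipped with an invariant, symmetric, nondegenerate bilinear form $\langle\ ,\ \rangle$, let $\check{\mathcal{G}}=\{\omega\in\mathcal{G}\mid \sigma(\mathrm{ad}\,\omega)\cap 2\pi i\mathbf{Z}^*=\emptyset\}$, let $f(z)=\frac12\coth\frac z2-\frac1z$ for $z\in\mathbf{C}\setminus 2\pi i\mathbf{Z}^*$, and let $R:\check{\mathcal{G}}\to\mathrm{End}(\mathcal{G})$ be defined by the holomorphic functional calculus, $$R(\omega):=f(\mathrm{ad}\,\omega)=\frac{1}{2\pi i}\int_C d\xi\, f(\xi)\,(\xi I-\mathrm{ad}\,\omega)^{-1}.$$ Then: (i) (antisymmetry) $R(\omega)^T=-R(\omega)$ for all $\omega\in\check{\mathcal{G}}$; (ii) (equivariance) $(\nabla_{[S,\omega]}R)(\omega)=[\mathrm{ad}\,S,R(\omega)]$ for all $S\in\mathcal{G}$, $\omega\in\check{\mathcal{G}}$; (iii) (modified classical dynamical Yang-Baxter equation) for all $X,Y\in\mathcal{G}$ and $\omega\in\check{\mathcal{G}}$, $$\frac14[X,Y]+[R(\omega)X,R(\omega)Y]-R(\omega)\big([R(\omega)X,Y]+[X,R(\omega)Y]\big)+\langle X,(\nabla R)(\omega)Y\rangle+(\nabla_Y R)(\omega)X-(\nabla_X R)(\omega)Y=0.$$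
   Context: Here $\mathbf{Z}^*=\mathbf{Z}\setminus\{0\}$, $\sigma(A)$ is the spectrum of a linear operator $A$, $I$ is the identity operator on $\mathcal{G}$, and $(\mathrm{ad}\,\omega)(X)=[\omega,X]$. Invariance of $\langle\ ,\ \rangle$ means $\langle[\omega,X],Y\rangle=-\langle X,[\omega,Y]\rangle$ for all $\omega,X,Y\in\mathcal{G}$. The function $f$ is holomorphic on $\mathbf{C}\setminus 2\pi i\mathbf{Z}^*$, its singularity at $z=0$ being removable with $f(0)=0$. The transpose $A^T$ of $A\in\mathrm{End}(\mathcal{G})$ is defined by $\langle A^TX,Y\rangle=\langle X,AY\rangle$ for all $X,Y\in\mathcal{G}$. The set $\check{\mathcal{G}}$ is a nonempty open subset of $\mathcal{G}$. In the integral, $C$ is a closed rectifiable curve (possibly a finite union of such curves) lying in the domain of holomorphy of $f$ and encircling each eigenvalue of $\mathrm{ad}\,\omega$ once in the positive sense; the integral does not depend on its choice. The directional derivatives of $R$ are $(\nabla_SR)(\omega):=\frac{d}{dt}\big|_{t=0}R(\omega+tS)\in\mathrm{End}(\mathcal{G})$ for $S\in\mathcal{G}$, $\omega\in\check{\mathcal{G}}$. The gradient term is the $\mathcal{G}$-valued expression $$\langle X,(\nabla R)(\omega)Y\rangle:=\sum_j T^j\,\langle X,(\nabla_{T_j}R)(\omega)Y\rangle\in\mathcal{G},$$ where $\{T_j\}$ and $\{T^k\}$ are dual bases of $\mathcal{G}$, $\langle T_j,T^k\rangle=\delta_j^k$. In (ii) the bracket on the right-hand side is the commutator in $\mathrm{End}(\mathcal{G})$.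 *)

theory Defs
  imports "HOL-Complex_Analysis.Complex_Analysis"
begin

text \<open>
  The abstract space \<open>'g\<close> carries no topology.  Since it is finite-dimensional, integrals and
  derivatives of functions with values in \<open>'g\<close> or in \<open>End('g)\<close> are taken coordinatewise with
  respect to the basis \<open>E\<close> supplied by \<^locale>\<open>finite_dimensional_vector_space\<close>;
  they do not depend on that basis.
\<close>

locale metric_lie_algebra = finite_dimensional_vector_space smul E
  for smul :: "complex \<Rightarrow> 'g \<Rightarrow> 'g::ab_group_add"
    and E :: "'g set" +
  fixes bracket :: "'g \<Rightarrow> 'g \<Rightarrow> 'g"
    and form :: "'g \<Rightarrow> 'g \<Rightarrow> complex"
  assumes bracket_linear_left: "Vector_Spaces.linear smul smul (\<lambda>X. bracket X Y)"
    and bracket_linear_right: "Vector_Spaces.linear smul smul (\<lambda>Y. bracket X Y)"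
    and bracket_self: "bracket X X = 0"
    and jacobi: "bracket X (bracket Y Z) + bracket Y (bracket Z X) + bracket Z (bracket X Y) = 0"
    and form_linear_left: "Vector_Spaces.linear smul (*) (\<lambda>X. form X Y)"
    and form_linear_right: "Vector_Spaces.linear smul (*) (\<lambda>Y. form X Y)"
    and form_sym: "form X Y = form Y X"
    and form_nondegenerate: "(\<And>Y. form X Y = 0) \<Longrightarrow> X = 0"
    and form_invariant: "form (bracket W X) Y = - form X (bracket W Y)"

definition form_transpose :: "('g \<Rightarrow> 'g \<Rightarrow> complex) \<Rightarrow> ('g \<Rightarrow> 'g) \<Rightarrow> 'g \<Rightarrow> 'g"
  where "form_transpose form A = (THE A'. \<forall>X Y. form (A' X) Y = form X (A Y))"

definition commutator :: "('g \<Rightarrow> 'g) \<Rightarrow> ('g \<Rightarrow> 'g) \<Rightarrow> 'g \<Rightarrow> 'g::ab_group_add"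
  where "commutator A B = (\<lambda>X. A (B X) - B (A X))"

definition op_spectrum ::
    "(complex \<Rightarrow> 'g \<Rightarrow> 'g) \<Rightarrow> ('g \<Rightarrow> 'g::ab_group_add) \<Rightarrow> complex set"
  where "op_spectrum smul A = {z. \<not> bij (\<lambda>X. smul z X - A X)}"

definition resolvent ::
    "(complex \<Rightarrow> 'g \<Rightarrow> 'g) \<Rightarrow> ('g \<Rightarrow> 'g::ab_group_add) \<Rightarrow> complex \<Rightarrow> 'g \<Rightarrow> 'g"
  where "resolvent smul A z = inv (\<lambda>X. smul z X - A X)"

text \<open>
  An integration contour is a finite list of piecewise continuously differentiable loops.
  It lies in the domain \<open>U\<close>, its total winding number is 1 around every spectral point, and it
  is 0 around every point outside \<open>U\<close>: without the last condition the integral would pick up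
  the singularities of the integrated function and depend on the contour.
\<close>

definition encircles :: "complex set \<Rightarrow> complex set \<Rightarrow> (real \<Rightarrow> complex) list \<Rightarrow> bool"
  where "encircles U K C \<longleftrightarrow>
    (\<forall>\<gamma>\<in>set C. valid_path \<gamma> \<and> pathfinish \<gamma> = pathstart \<gamma> \<and> path_image \<gamma> \<subseteq> U - K) \<and>
    (\<forall>z\<in>K. (\<Sum>\<gamma>\<leftarrow>C. winding_number \<gamma> z) = 1) \<and>
    (\<forall>z. z \<notin> U \<longrightarrow> (\<Sum>\<gamma>\<leftarrow>C. winding_number \<gamma> z) = 0)"

definition vec_contour_integral ::
    "(complex \<Rightarrow> 'g \<Rightarrow> 'g) \<Rightarrow> 'g set \<Rightarrow> (real \<Rightarrow> complex) list \<Rightarrow> (complex \<Rightarrow> 'g) \<Rightarrow> 'g::ab_group_add"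
  where "vec_contour_integral smul E C F =
    (\<Sum>b\<in>E. smul
       (\<Sum>\<gamma>\<leftarrow>C. contour_integral \<gamma> (\<lambda>\<xi>. module.representation smul E (F \<xi>) b)) b)"

definition dunford_integral ::
    "(complex \<Rightarrow> 'g \<Rightarrow> 'g) \<Rightarrow> 'g set \<Rightarrow> (complex \<Rightarrow> complex) \<Rightarrow> ('g \<Rightarrow> 'g) \<Rightarrow>
     (real \<Rightarrow> complex) list \<Rightarrow> 'g \<Rightarrow> 'g::ab_group_add"
  where "dunford_integral smul E g A C X =
    smul (1 / (2 * of_real pi * \<i>))
      (vec_contour_integral smul E C (\<lambda>\<xi>. smul (g \<xi>) (resolvent smul A \<xi> X)))"

text \<open>The common value of the Dunford integrals over all contours admissible for \<open>U\<close> and \<open>A\<close>.\<close>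

definition functional_calculus ::
    "(complex \<Rightarrow> 'g \<Rightarrow> 'g) \<Rightarrow> 'g set \<Rightarrow> complex set \<Rightarrow> (complex \<Rightarrow> complex) \<Rightarrow>
     ('g \<Rightarrow> 'g) \<Rightarrow> 'g \<Rightarrow> 'g::ab_group_add"
  where "functional_calculus smul E U g A =
    (THE T. \<forall>C. encircles U (op_spectrum smul A) C \<longrightarrow> T = dunford_integral smul E g A C)"

definition coth_poles :: "complex set"
  where "coth_poles = {2 * of_real pi * \<i> * of_int k | k. k \<noteq> 0}"

definition coth_fun :: "complex \<Rightarrow> complex"
  where "coth_fun z = (if z = 0 then 0 else (1/2) * (cosh (z/2) / sinh (z/2)) - 1 / z)"

definition regular_set ::
    "(complex \<Rightarrow> 'g \<Rightarrow> 'g) \<Rightarrow> ('g \<Rightarrow> 'g \<Rightarrow> 'g) \<Rightarrow> 'g::ab_group_add set"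
  where "regular_set smul bracket = {\<omega>. op_spectrum smul (bracket \<omega>) \<inter> coth_poles = {}}"

definition r_matrix ::
    "(complex \<Rightarrow> 'g \<Rightarrow> 'g) \<Rightarrow> 'g set \<Rightarrow> ('g \<Rightarrow> 'g \<Rightarrow> 'g) \<Rightarrow> 'g \<Rightarrow> 'g \<Rightarrow> 'g::ab_group_add"
  where "r_matrix smul E bracket \<omega> =
    functional_calculus smul E (- coth_poles) coth_fun (bracket \<omega>)"

text \<open>
  The contour integral defining the r-matrix makes sense at \<open>\<omega>\<close>: admissible contours exist, all of
  them give the same value, and this value is an endomorphism.  The theorem asserts this alongside
  its main claims, so that no claim rests on an unspecified value of \<open>THE\<close>.
\<close>

definition r_matrix_well_defined ::
    "(complex \<Rightarrow> 'g \<Rightarrow> 'g) \<Rightarrow> 'g set \<Rightarrow> ('g \<Rightarrow> 'g \<Rightarrow> 'g) \<Rightarrow> 'g::ab_group_add \<Rightarrow> bool"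
  where "r_matrix_well_defined smul E bracket \<omega> \<longleftrightarrow>
    (\<exists>C. encircles (- coth_poles) (op_spectrum smul (bracket \<omega>)) C) \<and>
    (\<forall>C. encircles (- coth_poles) (op_spectrum smul (bracket \<omega>)) C \<longrightarrow>
       r_matrix smul E bracket \<omega> = dunford_integral smul E coth_fun (bracket \<omega>) C) \<and>
    Vector_Spaces.linear smul smul (r_matrix smul E bracket \<omega>)"

text \<open>The parameter \<open>t\<close> of the directional derivative is complex.\<close>

definition has_dir_deriv ::
    "(complex \<Rightarrow> 'g \<Rightarrow> 'g) \<Rightarrow> 'g set \<Rightarrow> ('g \<Rightarrow> 'g \<Rightarrow> 'g) \<Rightarrow> 'g \<Rightarrow> 'g \<Rightarrow>
     ('g \<Rightarrow> 'g::ab_group_add) \<Rightarrow> bool"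
  where "has_dir_deriv smul E R S \<omega> D \<longleftrightarrow>
    Vector_Spaces.linear smul smul D \<and>
    (\<forall>Y. \<forall>b\<in>E.
      ((\<lambda>t. module.representation smul E (R (\<omega> + smul t S) Y) b)
         has_field_derivative module.representation smul E (D Y) b) (at 0))"

definition dir_deriv ::
    "(complex \<Rightarrow> 'g \<Rightarrow> 'g) \<Rightarrow> 'g set \<Rightarrow> ('g \<Rightarrow> 'g \<Rightarrow> 'g) \<Rightarrow> 'g \<Rightarrow> 'g \<Rightarrow> 'g \<Rightarrow> 'g::ab_group_add"
  where "dir_deriv smul E R S \<omega> = (THE D. has_dir_deriv smul E R S \<omega> D)"

definition basis_family ::
    "(complex \<Rightarrow> 'g \<Rightarrow> 'g::ab_group_add) \<Rightarrow> 'i set \<Rightarrow> ('i \<Rightarrow> 'g) \<Rightarrow> bool"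
  where "basis_family smul J T \<longleftrightarrow>
    finite J \<and> inj_on T J \<and> \<not> module.dependent smul (T ` J) \<and> module.span smul (T ` J) = UNIV"

definition dual_bases ::
    "(complex \<Rightarrow> 'g \<Rightarrow> 'g::ab_group_add) \<Rightarrow> ('g \<Rightarrow> 'g \<Rightarrow> complex) \<Rightarrow>
     'i set \<Rightarrow> ('i \<Rightarrow> 'g) \<Rightarrow> ('i \<Rightarrow> 'g) \<Rightarrow> bool"
  where "dual_bases smul form J T T' \<longleftrightarrow>
    basis_family smul J T \<and> basis_family smul J T' \<and>
    (\<forall>j\<in>J. \<forall>k\<in>J. form (T j) (T' k) = (if j = k then 1 else 0))"

text \<open>Here \<open>T\<close> is the basis with lower and \<open>T'\<close> the dual basis with upper indices.\<close>

definition gradient_term ::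
    "(complex \<Rightarrow> 'g \<Rightarrow> 'g) \<Rightarrow> 'g set \<Rightarrow> ('g \<Rightarrow> 'g \<Rightarrow> complex) \<Rightarrow> 'i set \<Rightarrow> ('i \<Rightarrow> 'g) \<Rightarrow>
     ('i \<Rightarrow> 'g) \<Rightarrow> ('g \<Rightarrow> 'g \<Rightarrow> 'g) \<Rightarrow> 'g \<Rightarrow> 'g \<Rightarrow> 'g \<Rightarrow> 'g::ab_group_add"
  where "gradient_term smul E form J T T' R \<omega> X Y =
    (\<Sum>j\<in>J. smul (form X (dir_deriv smul E R (T j) \<omega> Y)) (T' j))"

end

theory Submission
  imports Defs "HOL-Computational_Algebra.Fundamental_Theorem_Algebra"
begin

text \<open>Write \<open>D\<close> for \<open>ad \<omega>\<close>, \<open>K\<close> for its spectrum, and \<open>res z\<close> for \<open>(z - D)\<^sup>-\<^sup>1\<close>.  The idea is that on a generalised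
  eigenvector everything is a finite Taylor expansion, and generalised eigenvectors span the space
  (\<open>span_gen_eigs\<close>).  If \<open>(D - l)\<^sup>n X = 0\<close>, then \<open>res z X\<close> is the finite sum of the
  \<open>(z - l)\<^sup>-\<^sup>k\<^sup>-\<^sup>1 (D - l)\<^sup>k X\<close> for \<open>k < n\<close>.  By the residue theorem the Dunford integral over any admissible
  cycle only sees the residues at \<open>K\<close> (\<open>cycle_residue_theorem\<close>), hence
  \<open>R X\<close> is the sum of the \<open>f\<^sub>k(l) (D - l)\<^sup>k X\<close>, where the \<open>f\<^sub>k(l)\<close> are the Taylor coefficients of \<open>f\<close> at \<open>l\<close>.
  This gives independence of the contour.

  Keeping one contour of small circles fixed while \<open>\<omega>\<close> moves to \<open>\<omega> + t S\<close>, the resolvent identity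
  yields \<open>(\<nabla>\<^sub>S R) X = L (res z [S, res z X])\<close>, where \<open>L\<close> stands for integration against
  \<open>f(z) dz / (2 \<pi> \<i>)\<close> (\<open>has_field_derivative_calculus\<close>).  The three claims are then read off under \<open>L\<close>.

  Equivariance: \<open>ad [S, \<omega>]\<close> is the commutator of \<open>ad S\<close> with \<open>D\<close>, hence of \<open>z - D\<close> with \<open>ad S\<close>; put between
  two resolvents it collapses to \<open>[S, res z X] - res z [S, X]\<close>.

  Antisymmetry: \<open>D\<close> is skew for the form, so the transpose of \<open>res z\<close> is \<open>(z + D)\<^sup>-\<^sup>1\<close>, and \<open>f\<close> is odd.

  Dynamical Yang-Baxter equation: let \<open>X\<close>, \<open>Y\<close> be generalised eigenvectors for \<open>l\<close>, \<open>m\<close>.  Let \<open>x\<close> and \<open>y\<close> be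
  the nilpotent operators \<open>D - l\<close> on the left and \<open>D - m\<close> on the right entry of the bracket, and put
  \<open>a = l + x\<close>, \<open>b = m + y\<close>.  Since \<open>D\<close> is a derivation, it acts on the value of the bracket as \<open>a + b\<close>.  So each
  term of the equation is a power series in \<open>x\<close>, \<open>y\<close> applied to \<open>[X, Y]\<close>: the algebraic terms give
  \<open>1/4 + f(a) f(b) - f(a + b) (f(a) + f(b))\<close>, and the three derivative terms are divided differences of \<open>f\<close>,
  namely \<open>(f(a) + f(b)) / (a + b)\<close>, \<open>(f(a + b) - f(a)) / b\<close> and \<open>(f(a + b) - f(b)) / a\<close>, all with a minus sign.
  Substituting \<open>f(z) = F(z) - 1/z\<close> with \<open>F(z) = coth(z/2) / 2\<close>, the sum becomes
  \<open>1/4 + F(a) F(b) - F(a + b) (F(a) + F(b))\<close>, which vanishes by the addition formula of \<open>coth\<close>.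

  The divisions make no sense for operators when \<open>l\<close>, \<open>m\<close> or \<open>l + m\<close> is 0.  The
  computation is therefore done with \<open>x\<close> and \<open>y\<close> as formal variables, in a ring of formal power series
  without zero divisors, where \<open>a\<close>, \<open>b\<close>, \<open>a + b\<close> can be cancelled (\<open>formal_dybe\<close>).  The map from formal series
  to vectors is \<open>eval2\<close>; its compatibility with \<open>R\<close> and \<open>res z\<close> is \<open>eval2_mult_subst\<close>.\<close>

section \<open>Residues along cycles\<close>

text \<open>Inside a ball that contains the cycle and \<open>K\<close> there are only finitely many points outside of \<open>U\<close>, so the
  residue theorem for that ball applies to each loop separately.  The total winding numbers
  prescribed by \<^const>\<open>encircles\<close> then remove the points outside of \<open>U\<close> and weight those of \<open>K\<close> by 1.\<close>

lemma cycle_residue_theorem: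
  assumes disc: "\<And>r. finite (cball 0 r - U)" and K: "finite K"
    and h: "h holomorphic_on U - K" and C: "encircles U K C"
  shows "(\<Sum>\<gamma>\<leftarrow>C. contour_integral \<gamma> h) = 2 * of_real pi * \<i> * (\<Sum>p\<in>K. residue h p)"
proof -
  have path: "valid_path \<gamma>" "pathfinish \<gamma> = pathstart \<gamma>" "path_image \<gamma> \<subseteq> U - K" if "\<gamma> \<in> set C" for \<gamma>
    using C that by (auto simp: encircles_def)
  have "compact (\<Union>\<gamma>\<in>set C. path_image \<gamma>)"
    by (intro compact_UN) (auto intro: compact_valid_path_image path)
  then have "bounded ((\<Union>\<gamma>\<in>set C. path_image \<gamma>) \<union> K)"
    using K by (auto intro: compact_imp_bounded finite_imp_bounded)
  then obtain r where r: "(\<Union>\<gamma>\<in>set C. path_image \<gamma>) \<union> K \<subseteq> ball 0 r"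
    using bounded_subset_ballD by blast
  define pts where "pts = K \<union> (ball 0 r - U)"
  have "finite (ball 0 r - U)" by (rule finite_subset[OF _ disc[of r]]) auto
  then have fin: "finite pts" using K by (simp add: pts_def)
  have 1: "contour_integral \<gamma> h = 2 * of_real pi * \<i> * (\<Sum>p\<in>pts. winding_number \<gamma> p * residue h p)"
    if "\<gamma> \<in> set C" for \<gamma>
  proof (rule Residue_theorem[of "ball 0 r" pts h \<gamma>, simplified])
    show "h holomorphic_on ball 0 r - pts"
      by (rule holomorphic_on_subset[OF h]) (auto simp: pts_def)
    show "path_image \<gamma> \<subseteq> ball 0 r - pts"
      using r path[OF that] that by (auto simp: pts_def)
    show "\<forall>z. \<not> norm z < r \<longrightarrow> winding_number \<gamma> z = 0"
      using r path[OF that] that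
      by (intro allI impI winding_number_zero_outside[of _ "ball 0 r"]) (auto intro: valid_path_imp_path)
  qed (use path[OF that] fin in auto)
  have "(\<Sum>\<gamma>\<leftarrow>C. contour_integral \<gamma> h)
      = (\<Sum>\<gamma>\<leftarrow>C. 2 * of_real pi * \<i> * (\<Sum>p\<in>pts. winding_number \<gamma> p * residue h p))"
    by (intro arg_cong[of _ _ sum_list] map_cong) (auto simp: 1)
  also have "\<dots> = 2 * of_real pi * \<i> * (\<Sum>p\<in>pts. (\<Sum>\<gamma>\<leftarrow>C. winding_number \<gamma> p) * residue h p)"
    by (induction C) (auto simp: algebra_simps sum.distrib sum_distrib_left)
  also have "(\<Sum>p\<in>pts. (\<Sum>\<gamma>\<leftarrow>C. winding_number \<gamma> p) * residue h p) = (\<Sum>p\<in>K. residue h p)"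
  proof (rule sum.mono_neutral_cong_right)
    show "\<forall>p\<in>pts - K. (\<Sum>\<gamma>\<leftarrow>C. winding_number \<gamma> p) * residue h p = 0"
      using C by (auto simp: pts_def encircles_def)
    show "(\<Sum>\<gamma>\<leftarrow>C. winding_number \<gamma> p) * residue h p = residue h p" if "p \<in> K" for p
      using C that by (auto simp: encircles_def)
  qed (use fin in \<open>auto simp: pts_def\<close>)
  finally show ?thesis .
qed

text \<open>Up to the factor \<open>2 \<pi> \<i>\<close> this is the integral of \<open>f h\<close> around \<open>K\<close>.  In this form the integral refers to no
  contour, and its algebraic properties need no integrability conditions along paths.\<close>

definition residue_sum :: "(complex \<Rightarrow> complex) \<Rightarrow> complex set \<Rightarrow> (complex \<Rightarrow> complex) \<Rightarrow> complex"
  where "residue_sum f K h = (\<Sum>p\<in>K. residue (\<lambda>z. f z * h z) p)"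

text \<open>The integrands are holomorphic off \<open>K\<close>, while \<open>f\<close> is holomorphic on a neighbourhood of \<open>K\<close>; on
  such integrands the residue sum is a linear functional.\<close>

locale residue_functional =
  fixes f :: "complex \<Rightarrow> complex" and U K :: "complex set"
  assumes open_dom: "open U" and finite_poles: "finite K" and poles_dom: "K \<subseteq> U"
    and holo: "f holomorphic_on U"
begin

abbreviation "L \<equiv> residue_sum f K"

lemma isolated_pole:
  assumes "p \<in> K"
  shows "open (U - (K - {p}))" "p \<in> U - (K - {p})"
    and "h holomorphic_on -K \<Longrightarrow> (\<lambda>z. f z * h z) holomorphic_on (U - (K - {p})) - {p}"
proof -
  show "open (U - (K - {p}))" using open_dom finite_poles by (simp add: finite_imp_closed open_Diff)
  show "p \<in> U - (K - {p})" using assms poles_dom by auto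
  show "(\<lambda>z. f z * h z) holomorphic_on (U - (K - {p})) - {p}" if "h holomorphic_on -K"
    by (intro holomorphic_on_mult holomorphic_on_subset[OF that] holomorphic_on_subset[OF holo])
       (use assms in auto)
qed

lemma L_add:
  assumes "h holomorphic_on -K" "g holomorphic_on -K"
  shows "L (\<lambda>z. h z + g z) = L h + L g"
  unfolding residue_sum_def sum.distrib[symmetric] distrib_left
  by (intro sum.cong refl residue_add[OF isolated_pole(1,2)] isolated_pole(3) assms)

lemma L_cmult:
  assumes "h holomorphic_on -K"
  shows "L (\<lambda>z. c * h z) = c * L h"
  unfolding residue_sum_def sum_distrib_left mult.left_commute[of _ c]
  by (intro sum.cong refl residue_lmul[OF isolated_pole(1,2)] isolated_pole(3) assms)

lemma L_zero [simp]: "L (\<lambda>z. 0) = 0"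
  using L_cmult[of "\<lambda>z. 0" 0] by simp

lemma L_minus: "h holomorphic_on -K \<Longrightarrow> L (\<lambda>z. - h z) = - L h"
  using L_cmult[of h "-1"] by simp

lemma L_diff:
  assumes "h holomorphic_on -K" "g holomorphic_on -K"
  shows "L (\<lambda>z. h z - g z) = L h - L g"
  using L_add[OF assms(1), of "\<lambda>z. - g z"] L_minus[OF assms(2)] assms(2)
  by (simp add: holomorphic_on_minus)

lemma L_sum:
  assumes "\<And>i. i \<in> I \<Longrightarrow> h i holomorphic_on -K"
  shows "L (\<lambda>z. \<Sum>i\<in>I. h i z) = (\<Sum>i\<in>I. L (h i))"
  using assms by (induction I rule: infinite_finite_induct) (auto simp: L_add holomorphic_on_sum)

lemma L_cong:
  assumes "\<And>z. z \<notin> K \<Longrightarrow> h z = g z"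
  shows "L h = L g"
  unfolding residue_sum_def
proof (intro sum.cong refl residue_cong)
  fix p assume p: "p \<in> K"
  show "\<forall>\<^sub>F z in at p. f z * h z = f z * g z"
    unfolding eventually_at_topological
    by (rule exI[of _ "- (K - {p})"], safe)
       (use finite_poles assms in \<open>auto simp: finite_imp_closed simp del: Compl_Diff_eq\<close>)
qed

text \<open>Cauchy's formula for the Taylor coefficients of \<open>f\<close>.  Every integrand below reduces to such pole
  powers, because resolvents are rational functions of \<open>z\<close> with poles in the spectrum.\<close>

lemma L_power:
  assumes "p \<in> K"
  shows "L (\<lambda>z. inverse (z - p) ^ Suc k) = fps_nth (fps_expansion f p) k"
proof -
  have "residue (\<lambda>z. f z * inverse (z - p) ^ Suc k) q = (if q = p then fps_nth (fps_expansion f p) k else 0)"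
    if "q \<in> K" for q
  proof (cases "q = p")
    case True
    have "residue (\<lambda>z. f z / (z - p) ^ Suc k) p = (deriv ^^ k) f p / fact k"
      using residue_holomorphic_over_power[OF open_dom _ holo] assms poles_dom by blast
    then show ?thesis using True by (simp add: fps_expansion_def field_simps)
  next
    case False
    have "residue (\<lambda>z. f z * inverse (z - p) ^ Suc k) q = 0"
    proof (rule residue_holo)
      show "open (U - {p})" using open_dom by auto
      show "(\<lambda>z. f z * inverse (z - p) ^ Suc k) holomorphic_on U - {p}"
        by (intro holomorphic_intros holomorphic_on_subset[OF holo]) auto
    qed (use False that poles_dom in auto)
    then show ?thesis using False by simp
  qed
  then have "L (\<lambda>z. inverse (z - p) ^ Suc k)
      = (\<Sum>q\<in>K. if q = p then fps_nth (fps_expansion f p) k else 0)"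
    unfolding residue_sum_def by (intro sum.cong) auto
  then show ?thesis using assms finite_poles by simp
qed

lemma holomorphic_pole_power:
  "p \<in> K \<Longrightarrow> (\<lambda>z. inverse (z - p) ^ k) holomorphic_on -K"
  by (intro holomorphic_intros) auto

end

section \<open>The function \<open>f(z) = coth(z/2)/2 - 1/z\<close>\<close>

lemma coth_poles_locally_finite: "finite (cball 0 r \<inter> coth_poles)"
proof -
  have "cball 0 r \<inter> coth_poles \<subseteq> (\<lambda>k. 2 * of_real pi * \<i> * of_int k) ` {- \<lceil>\<bar>r\<bar>\<rceil> .. \<lceil>\<bar>r\<bar>\<rceil>}"
  proof
    fix z assume "z \<in> cball 0 r \<inter> coth_poles"
    then obtain k :: int where k: "z = 2 * of_real pi * \<i> * of_int k" and "norm z \<le> r"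
      by (auto simp: coth_poles_def)
    then have "2 * pi * \<bar>of_int k\<bar> \<le> r" by (simp add: norm_mult)
    moreover have "1 * \<bar>real_of_int k\<bar> \<le> 2 * pi * \<bar>of_int k\<bar>"
      using pi_gt3 by (intro mult_right_mono) auto
    ultimately have "\<bar>real_of_int k\<bar> \<le> \<bar>r\<bar>" by linarith
    then have "k \<in> {- \<lceil>\<bar>r\<bar>\<rceil> .. \<lceil>\<bar>r\<bar>\<rceil>}" by simp linarith
    then show "z \<in> (\<lambda>k. 2 * of_real pi * \<i> * of_int k) ` {- \<lceil>\<bar>r\<bar>\<rceil> .. \<lceil>\<bar>r\<bar>\<rceil>}"
      using k by blast
  qed
  then show ?thesis by (rule finite_subset) auto
qed

lemma closed_coth_poles: "closed coth_poles"
proof (rule discrete_imp_closed[of "2 * pi"], safe)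
  fix y z assume "y \<in> coth_poles" "z \<in> coth_poles" and d: "dist z y < 2 * pi"
  then obtain j k :: int where *: "y = 2 * of_real pi * \<i> * of_int j" "z = 2 * of_real pi * \<i> * of_int k"
    by (auto simp: coth_poles_def)
  have "z - y = 2 * of_real pi * \<i> * of_int (k - j)" by (simp add: * algebra_simps)
  then have "dist z y = 2 * pi * \<bar>of_int (k - j)\<bar>"
    by (simp add: dist_norm norm_mult flip: of_int_diff of_int_abs)
  with d have "\<bar>k - j\<bar> < 1" by (simp flip: of_int_abs)
  then show "z = y" by (simp add: *)
qed auto

lemma exp_eq_1_imp_coth_pole:
  assumes "exp z = 1" "z \<noteq> 0" shows "z \<in> coth_poles"
proof -
  obtain n :: int where "Re z = 0" "Im z = of_int (2 * n) * pi" using assms unfolding exp_eq_1 by auto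
  then have "z = 2 * of_real pi * \<i> * of_int n" by (simp add: complex_eq_iff)
  with assms show ?thesis by (auto simp: coth_poles_def)
qed

text \<open>With the denominators cleared, the definition of \<open>f\<close> becomes an equation between functions that are holomorphic at
  every regular point, 0 included.  It can be expanded into Taylor series there, and it is the only property of
  \<open>f\<close>, besides oddness, that the algebra below uses.\<close>

lemma coth_fun_equation:
  assumes "z \<notin> coth_poles"
  shows "2 * (z * coth_fun z + 1) * (exp z - 1) = z * (exp z + 1)"
proof (cases "z = 0")
  case False
  define w where "w = exp (z / 2)"
  have w: "w \<noteq> 0" "exp z = w ^ 2" "exp (- (z/2)) = 1 / w"
    by (simp_all add: w_def exp_minus field_simps flip: exp_double)
  have "exp z \<noteq> 1" using exp_eq_1_imp_coth_pole False assms by blast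
  then have ne: "w ^ 2 - 1 \<noteq> 0" using w by simp
  have sinh_cosh: "sinh (z/2) = (w^2 - 1) / (2 * w)" "cosh (z/2) = (w^2 + 1) / (2 * w)"
    using w by (simp_all add: sinh_field_def cosh_field_def field_simps power2_eq_square flip: w_def)
  have "z * coth_fun z + 1 = z / 2 * ((w^2 + 1) / (w^2 - 1))"
    unfolding coth_fun_def sinh_cosh using False w ne by (simp add: field_simps)
  then show ?thesis using ne w by (simp add: field_simps)
qed simp

lemma coth_fun_minus: "coth_fun (- z) = - coth_fun z"
  by (simp add: coth_fun_def)

lemma holomorphic_quotient_by_z:
  assumes "h holomorphic_on UNIV" "h 0 = 0"
  obtains g where "g holomorphic_on UNIV" "\<And>z. h z = z * g z" "g 0 = deriv h 0"
proof
  let ?g = "\<lambda>w. if w = 0 then deriv h 0 else (h w - h 0) / (w - 0)"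
  show "?g holomorphic_on UNIV" by (rule pole_lemma) (use assms in auto)
qed (use assms in auto)

text \<open>The numerator \<open>z (e\<^sup>z + 1) - 2 (e\<^sup>z - 1)\<close> vanishes at 0 to order at least two and the denominator
  \<open>2 z (e\<^sup>z - 1)\<close> to order exactly two, so the quotient extends holomorphically over 0.  The extension is
  odd, which identifies its value at 0 with the value 0 chosen for \<^const>\<open>coth_fun\<close>.\<close>

lemma holomorphic_coth_fun: "coth_fun holomorphic_on - coth_poles"
proof -
  define n :: "complex \<Rightarrow> complex" where "n = (\<lambda>z. z * (exp z + 1) - 2 * (exp z - 1))"
  have dn: "deriv n 0 = 0"
    by (rule DERIV_imp_deriv) (auto simp: n_def intro!: derivative_eq_intros)
  have "n holomorphic_on UNIV" "n 0 = 0" unfolding n_def by (auto intro!: holomorphic_intros)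
  then obtain q where q: "q holomorphic_on UNIV" "\<And>z. n z = z * q z" "q 0 = deriv n 0"
    using holomorphic_quotient_by_z by blast
  then obtain r where r: "r holomorphic_on UNIV" "\<And>z. q z = z * r z"
    using holomorphic_quotient_by_z[OF q(1)] dn by metis
  have de: "deriv (\<lambda>z. exp z - 1) 0 = (1::complex)"
    by (rule DERIV_imp_deriv) (auto intro!: derivative_eq_intros)
  have "(\<lambda>z. exp z - 1) holomorphic_on UNIV" "exp 0 - 1 = (0::complex)"
    by (auto intro!: holomorphic_intros)
  from holomorphic_quotient_by_z[OF this, unfolded de]
  obtain t where t: "t holomorphic_on UNIV" "\<And>z. exp z - 1 = z * t z" "t 0 = (1::complex)"
    by blast
  have t0: "t z \<noteq> 0" if "z \<notin> coth_poles" for z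
    using t(2)[of z] t(3) exp_eq_1_imp_coth_pole[of z] that by (cases "z = 0") auto
  define g where "g = (\<lambda>z. r z / (2 * t z))"
  have g: "g holomorphic_on - coth_poles" unfolding g_def
    by (intro holomorphic_intros holomorphic_on_subset[OF r(1)] holomorphic_on_subset[OF t(1)])
       (use t0 in auto)
  have eq: "g z = coth_fun z" if "z \<notin> coth_poles" "z \<noteq> 0" for z
  proof -
    have "z * (2 * coth_fun z * (exp z - 1)) = 2 * (z * coth_fun z + 1) * (exp z - 1) - 2 * (exp z - 1)"
      by (simp add: algebra_simps)
    also have "\<dots> = n z" unfolding coth_fun_equation[OF that(1)] n_def ..
    also have "\<dots> = z * (z * r z)" using q(2) r(2) by metis
    finally have "z * (2 * coth_fun z * (exp z - 1)) = z * (z * r z)" .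
    then have "z * (2 * coth_fun z * t z) = z * r z" using that(2) unfolding t(2) by (simp add: mult_ac)
    then have "2 * coth_fun z * t z = r z" using that(2) by simp
    then show ?thesis using t0[OF that(1)] by (simp add: g_def eq_divide_eq mult_ac flip: \<open>2 * coth_fun z * t z = r z\<close>)
  qed
  have op: "open (- coth_poles)" using closed_coth_poles by blast
  have zero: "0 \<in> - coth_poles" by (auto simp: coth_poles_def)
  have sym: "- z \<notin> coth_poles" if "z \<notin> coth_poles" for z
  proof
    assume "- z \<in> coth_poles"
    then obtain k :: int where "- z = 2 * of_real pi * \<i> * of_int k" "k \<noteq> 0"
      by (auto simp: coth_poles_def)
    then have "z = 2 * of_real pi * \<i> * of_int (- k)" "- k \<noteq> 0"
      by (simp_all add: minus_equation_iff[of z])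
    with that show False unfolding coth_poles_def by blast
  qed
  have lim: "g \<midarrow>0\<rightarrow> g 0"
    using holomorphic_on_imp_continuous_on[OF g] op zero by (simp add: continuous_on_eq_continuous_at isCont_def)
  have "((\<lambda>z. - g (- z)) \<longlongrightarrow> - g 0) (at 0)"
    by (intro tendsto_minus tendsto_compose_at[OF _ lim, unfolded o_def, of uminus, simplified])
       (auto intro!: tendsto_eq_intros)
  moreover have "\<forall>\<^sub>F z in at 0. - g (- z) = g z"
    unfolding eventually_at_topological
    by (rule exI[of _ "- coth_poles"]) (use op zero sym eq in \<open>auto simp: coth_fun_minus\<close>)
  ultimately have "(g \<longlongrightarrow> - g 0) (at 0)" by (rule Lim_transform_eventually)
  with lim have "g 0 = - g 0" using tendsto_unique[OF at_neq_bot] by blast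
  then have "2 * g 0 = 0" by (metis add.right_inverse mult_2)
  then have "g 0 = coth_fun 0" by (simp add: coth_fun_def)
  then have "g z = coth_fun z" if "z \<in> - coth_poles" for z
    using that eq[of z] by (cases "z = 0") simp_all
  with g show ?thesis by (rule holomorphic_transform)
qed

section \<open>Coordinates in a finite-dimensional complex space\<close>

locale fd_complex_space = finite_dimensional_vector_space smul E
  for smul :: "complex \<Rightarrow> 'g \<Rightarrow> 'g::ab_group_add" (infixr "*\<^sub>C" 75) and E :: "'g set"
begin

abbreviation crd :: "'g \<Rightarrow> 'g \<Rightarrow> complex"
  where "crd \<equiv> representation E"

lemma linear_crd: "Vector_Spaces.linear smul (*) (\<lambda>X. crd X b)"
  by (rule linear_representation[OF independent_Basis span_Basis])

sublocale crd: Vector_Spaces.linear smul "(*)" "\<lambda>X. crd X b" for b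
  by (rule linear_crd)

lemma crd_expand: "(\<Sum>b\<in>E. crd X b *\<^sub>C b) = X"
  by (rule sum_representation_eq[OF independent_Basis _ finite_Basis]) (auto simp: span_Basis)

lemma crd_eqI:
  assumes "\<And>b. b \<in> E \<Longrightarrow> crd X b = crd Y b" shows "X = Y"
proof -
  have "(\<Sum>b\<in>E. crd X b *\<^sub>C b) = (\<Sum>b\<in>E. crd Y b *\<^sub>C b)" using assms by simp
  then show ?thesis by (simp only: crd_expand)
qed

lemma crd_sum_basis: "b \<in> E \<Longrightarrow> crd (\<Sum>e\<in>E. c e *\<^sub>C e) b = c b"
  by (simp add: crd.sum crd.scale representation_basis[OF independent_Basis] finite_Basis
      if_distrib[of "\<lambda>x. _ * x"] cong: sum.cong if_cong)

lemma functional_expand: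
  assumes "Vector_Spaces.linear smul (*) \<phi>" shows "\<phi> X = (\<Sum>b\<in>E. crd X b * \<phi> b)"
proof -
  interpret \<phi>: Vector_Spaces.linear smul "(*)" \<phi> by fact
  have "\<phi> X = \<phi> (\<Sum>b\<in>E. crd X b *\<^sub>C b)" by (simp only: crd_expand)
  then show ?thesis by (simp add: \<phi>.sum \<phi>.scale)
qed

lemma operator_expand:
  assumes "Vector_Spaces.linear smul smul A" shows "A X = (\<Sum>b\<in>E. crd X b *\<^sub>C A b)"
proof -
  interpret A: Vector_Spaces.linear smul smul A by fact
  have "A X = A (\<Sum>b\<in>E. crd X b *\<^sub>C b)" by (simp only: crd_expand)
  then show ?thesis by (simp add: A.sum A.scale)
qed

lemma linear_funpow:
  assumes "Vector_Spaces.linear smul smul N" shows "Vector_Spaces.linear smul smul (N ^^ k)"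
proof (induction k)
  case (Suc k)
  show ?case using Vector_Spaces.linear_compose[OF Suc assms] by (simp add: o_def)
qed (simp add: linear_id[unfolded id_def] id_def)

text \<open>The space carries no topology, so holomorphy and size of vectors are expressed in coordinates.\<close>

definition vholo :: "complex set \<Rightarrow> (complex \<Rightarrow> 'g) \<Rightarrow> bool"
  where "vholo S F \<longleftrightarrow> (\<forall>b\<in>E. (\<lambda>z. crd (F z) b) holomorphic_on S)"

lemma vholo_functional:
  assumes "Vector_Spaces.linear smul (*) \<phi>" "vholo S F"
  shows "(\<lambda>z. \<phi> (F z)) holomorphic_on S"
  unfolding functional_expand[OF assms(1), of "F _"]
  using assms(2) by (auto simp: vholo_def intro!: holomorphic_intros)

lemma vholo_const [simp]: "vholo S (\<lambda>z. X)"
  by (simp add: vholo_def)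

lemma vholo_cong: "(\<And>z. z \<in> S \<Longrightarrow> F z = G z) \<Longrightarrow> vholo S F \<longleftrightarrow> vholo S G"
  by (simp add: vholo_def cong: holomorphic_cong)

lemma vholo_add: "vholo S F \<Longrightarrow> vholo S G \<Longrightarrow> vholo S (\<lambda>z. F z + G z)"
  by (auto simp: vholo_def crd.add intro!: holomorphic_intros)

lemma vholo_scale: "h holomorphic_on S \<Longrightarrow> vholo S F \<Longrightarrow> vholo S (\<lambda>z. h z *\<^sub>C F z)"
  by (auto simp: vholo_def crd.scale intro!: holomorphic_intros)

lemma vholo_sum: "(\<And>i. i \<in> I \<Longrightarrow> vholo S (F i)) \<Longrightarrow> vholo S (\<lambda>z. \<Sum>i\<in>I. F i z)"
  by (auto simp: vholo_def crd.sum intro!: holomorphic_intros)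

text \<open>Expand \<open>F z\<close> in the basis: the result is a combination of the fixed-vector families \<open>A z b\<close> with
  holomorphic coefficients.\<close>

lemma vholo_operator_family:
  assumes lin: "\<And>z. z \<in> S \<Longrightarrow> Vector_Spaces.linear smul smul (A z)"
    and A: "\<And>X. vholo S (\<lambda>z. A z X)" and F: "vholo S F"
  shows "vholo S (\<lambda>z. A z (F z))"
proof -
  have "vholo S (\<lambda>z. \<Sum>b\<in>E. crd (F z) b *\<^sub>C A z b)"
    using F by (intro vholo_sum vholo_scale A) (auto simp: vholo_def)
  then show ?thesis
    by (subst vholo_cong[OF operator_expand[OF lin]])
qed

lemma vholo_operator: "Vector_Spaces.linear smul smul A \<Longrightarrow> vholo S F \<Longrightarrow> vholo S (\<lambda>z. A (F z))"
  by (rule vholo_operator_family) auto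

definition nrm :: "'g \<Rightarrow> real"
  where "nrm X = (\<Sum>b\<in>E. cmod (crd X b))"

lemma nrm_nonneg: "0 \<le> nrm X"
  by (simp add: nrm_def sum_nonneg)

lemma nrm_add: "nrm (X + Y) \<le> nrm X + nrm Y"
  unfolding nrm_def sum.distrib[symmetric] crd.add by (intro sum_mono norm_triangle_ineq)

lemma nrm_scale: "nrm (c *\<^sub>C X) = cmod c * nrm X"
  by (simp add: nrm_def crd.scale norm_mult sum_distrib_left)

lemma nrm_sum: "nrm (\<Sum>i\<in>I. F i) \<le> (\<Sum>i\<in>I. nrm (F i))"
proof (induction I rule: infinite_finite_induct)
  case (insert i I)
  then show ?case using nrm_add[of "F i" "sum F I"] by auto
qed (simp_all add: nrm_def crd.zero)

lemma crd_le_nrm: "b \<in> E \<Longrightarrow> cmod (crd X b) \<le> nrm X"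
  unfolding nrm_def by (rule member_le_sum) (auto simp: finite_Basis)

lemma nrm_eq_0: "nrm X = 0 \<Longrightarrow> X = 0"
  by (rule crd_eqI) (auto simp: nrm_def sum_nonneg_eq_0_iff finite_Basis crd.zero)

text \<open>A uniform boundedness principle: pointwise bounds on the finitely many basis vectors already give a common
  operator bound.  It turns estimates of the resolvent on single vectors into estimates of its norm.\<close>

lemma linear_family_bounded:
  assumes lin: "\<And>i. i \<in> I \<Longrightarrow> Vector_Spaces.linear smul smul (A i)"
    and bd: "\<And>X. \<exists>B. \<forall>i\<in>I. nrm (A i X) \<le> B"
  obtains B where "0 \<le> B" "\<And>i X. i \<in> I \<Longrightarrow> nrm (A i X) \<le> B * nrm X"
proof -
  obtain B where B: "\<And>X i. i \<in> I \<Longrightarrow> nrm (A i X) \<le> B X" using bd by metis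
  let ?C = "\<Sum>b\<in>E. \<bar>B b\<bar>"
  have "nrm (A i X) \<le> ?C * nrm X" if i: "i \<in> I" for i X
  proof -
    have "nrm (A i X) = nrm (\<Sum>b\<in>E. crd X b *\<^sub>C A i b)" by (subst operator_expand[OF lin[OF i]]) simp
    also have "\<dots> \<le> (\<Sum>b\<in>E. cmod (crd X b) * nrm (A i b))"
      using nrm_sum[of "\<lambda>b. crd X b *\<^sub>C A i b" E] by (simp add: nrm_scale)
    also have "\<dots> \<le> (\<Sum>b\<in>E. nrm X * \<bar>B b\<bar>)"
      using order_trans[OF B[OF i] abs_ge_self] by (intro sum_mono mult_mono crd_le_nrm) (auto simp: nrm_nonneg)
    finally show ?thesis by (simp add: sum_distrib_left mult.commute)
  qed
  then show thesis by (intro that[of ?C]) (auto intro: sum_nonneg)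
qed

end

section \<open>Generalised eigenvectors and the resolvent\<close>

locale fd_operator = fd_complex_space smul E
  for smul :: "complex \<Rightarrow> 'g \<Rightarrow> 'g::ab_group_add" (infixr "*\<^sub>C" 75) and E :: "'g set" +
  fixes D :: "'g \<Rightarrow> 'g"
  assumes linear_D: "Vector_Spaces.linear smul smul D"
begin

sublocale D: Vector_Spaces.linear smul smul D
  by (rule linear_D)

abbreviation "spec \<equiv> op_spectrum smul D"
abbreviation "res \<equiv> resolvent smul D"

definition shift :: "complex \<Rightarrow> 'g \<Rightarrow> 'g"
  where "shift l X = D X - l *\<^sub>C X"

lemma linear_shift: "Vector_Spaces.linear smul smul (shift l)"
  by unfold_locales (auto simp: shift_def D.add D.scale algebra_simps scale_left_commute)

sublocale shift: Vector_Spaces.linear smul smul "shift l" for l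
  by (rule linear_shift)

sublocale shift_power: Vector_Spaces.linear smul smul "shift l ^^ k" for l k
  by (rule linear_funpow[OF linear_shift])

lemma shift_power_shift: "(shift l ^^ k) (shift l X) = (shift l ^^ Suc k) X"
  by (simp add: funpow_swap1)

lemma shift_power_zero_mono:
  assumes "(shift l ^^ n) X = 0" "n \<le> m" shows "(shift l ^^ m) X = 0"
proof -
  have "(shift l ^^ m) X = (shift l ^^ (m - n)) ((shift l ^^ n) X)"
    using assms(2) by (simp flip: funpow_add o_apply[of "_ ^^ _"])
  then show ?thesis using assms(1) by (simp add: shift_power.zero)
qed

lemma shift_power_zero_shift:
  assumes "(shift l ^^ n) X = 0" shows "(shift l ^^ n) ((shift l ^^ k) X) = 0"
proof -
  have "(shift l ^^ n) ((shift l ^^ k) X) = (shift l ^^ (n + k)) X" by (simp add: funpow_add)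
  then show ?thesis using shift_power_zero_mono[OF assms, of "n + k"] by simp
qed

text \<open>The expansion of \<open>((z - l) - (D - l))\<^sup>-\<^sup>1 X\<close> in powers of \<open>D - l\<close>; it stops when \<open>(D - l)\<^sup>n X = 0\<close>.\<close>

definition neumann :: "complex \<Rightarrow> nat \<Rightarrow> complex \<Rightarrow> 'g \<Rightarrow> 'g"
  where "neumann l n z X = (\<Sum>k<n. (inverse (z - l) ^ Suc k) *\<^sub>C (shift l ^^ k) X)"

lemma neumann_inverts:
  assumes "(shift l ^^ n) X = 0" "z \<noteq> l"
  shows "z *\<^sub>C neumann l n z X - D (neumann l n z X) = X"
proof -
  let ?a = "\<lambda>k. (inverse (z - l) ^ k) *\<^sub>C (shift l ^^ k) X"
  have "z *\<^sub>C neumann l n z X - D (neumann l n z X) = (z - l) *\<^sub>C neumann l n z X - shift l (neumann l n z X)"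
    by (simp add: shift_def algebra_simps)
  also have "\<dots> = (\<Sum>k<n. ((z - l) * inverse (z - l) ^ Suc k) *\<^sub>C (shift l ^^ k) X)
        - (\<Sum>k<n. (inverse (z - l) ^ Suc k) *\<^sub>C shift l ((shift l ^^ k) X))"
    by (simp only: neumann_def scale_sum_right shift.sum shift.scale scale_scale)
  also have "\<dots> = (\<Sum>k<n. ?a k - ?a (Suc k))"
    using assms(2) by (simp add: sum_subtractf flip: mult.assoc)
  also have "\<dots> = ?a 0 - ?a n" by (rule sum_lessThan_telescope')
  finally show ?thesis using assms(1) by simp
qed

definition gen_eigs :: "'g set"
  where "gen_eigs = {X. \<exists>l n. (shift l ^^ n) X = 0}"

lemma gen_eigs_shift_power: "X \<in> gen_eigs \<Longrightarrow> (shift l ^^ n) X = 0 \<Longrightarrow> (shift l ^^ k) X \<in> gen_eigs"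
  unfolding gen_eigs_def using shift_power_zero_shift by blast

text \<open>\<open>D - l\<close> is invertible on generalised eigenvectors for eigenvalues \<open>m\<close> other than \<open>l\<close> (by the Neumann sum at \<open>z = l\<close>),
  so modulo its range only the part for \<open>l\<close> itself remains.\<close>

lemma span_gen_eigs_split:
  assumes "V \<in> span gen_eigs"
  shows "\<exists>W\<in>span gen_eigs. \<exists>n. (shift l ^^ n) (V - shift l W) = 0"
  using assms
proof (induction rule: span_induct_alt)
  case base
  then show ?case by (intro bexI[of _ 0] exI[of _ 0]) (auto simp: span_zero shift.zero)
next
  case (step c X V)
  then obtain W n where W: "W \<in> span gen_eigs" "(shift l ^^ n) (V - shift l W) = 0" by blast
  obtain m k where X: "(shift m ^^ k) X = 0" using step unfolding gen_eigs_def by blast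
  show ?case
  proof (cases "m = l")
    case True
    have "(shift l ^^ (max k n)) (V - shift l W) = 0" "(shift l ^^ (max k n)) X = 0"
      using W(2) X True shift_power_zero_mono by (meson max.cobounded1 max.cobounded2)+
    then have "(shift l ^^ (max k n)) (c *\<^sub>C X + V - shift l W) = 0"
      by (simp add: shift_power.add shift_power.scale shift_power.diff algebra_simps)
    then show ?thesis using W by blast
  next
    case False
    let ?Y = "neumann m k l X"
    have "?Y \<in> span gen_eigs" unfolding neumann_def
      by (intro span_sum span_scale span_base gen_eigs_shift_power[OF step(1) X])
    moreover have "c *\<^sub>C X = - shift l (c *\<^sub>C ?Y)"
    proof -
      have "X = - shift l ?Y" using neumann_inverts[OF X, of l] False by (simp add: shift_def)
      then show ?thesis by (metis scale_minus_right shift.scale)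
    qed
    ultimately show ?thesis using W
      by (intro bexI[of _ "W - c *\<^sub>C ?Y"] exI[of _ n])
         (auto simp: shift.diff shift_power.diff span_diff span_scale algebra_simps)
  qed
qed

text \<open>This is what makes an induction over the linear factors of an annihilating polynomial work: with the
  splitting above, \<open>(D - l) (Z - W)\<close> is a generalised eigenvector for \<open>l\<close>, hence so is \<open>Z - W\<close>.\<close>

lemma span_gen_eigs_shift:
  assumes "shift l Z \<in> span gen_eigs" shows "Z \<in> span gen_eigs"
proof -
  obtain W n where W: "W \<in> span gen_eigs" "(shift l ^^ n) (shift l Z - shift l W) = 0"
    using span_gen_eigs_split[OF assms] by blast
  then have "(shift l ^^ Suc n) (Z - W) = 0"
    unfolding shift_power_shift[symmetric] by (simp add: shift.diff shift_power.diff)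
  then have "Z - W \<in> gen_eigs" unfolding gen_eigs_def by blast
  then show ?thesis using W(1) span_add[OF span_base, of "Z - W" _ W] by simp
qed

definition op_poly :: "complex poly \<Rightarrow> 'g \<Rightarrow> 'g"
  where "op_poly p X = (\<Sum>i\<le>degree p. coeff p i *\<^sub>C (D ^^ i) X)"

lemma op_poly_bound: "degree p \<le> n \<Longrightarrow> op_poly p X = (\<Sum>i\<le>n. coeff p i *\<^sub>C (D ^^ i) X)"
  unfolding op_poly_def by (intro sum.mono_neutral_left) (auto simp: coeff_eq_0)

lemma op_poly_linear_factor: "op_poly ([:-l, 1:] * q) X = shift l (op_poly q X)"
proof -
  let ?n = "degree q"
  have "op_poly ([:-l, 1:] * q) X = (\<Sum>i\<le>Suc ?n. coeff ([:-l, 1:] * q) i *\<^sub>C (D ^^ i) X)"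
    using degree_mult_le[of "[:-l, 1:]" q] by (intro op_poly_bound) auto
  also have "\<dots> = (\<Sum>i\<le>Suc ?n. coeff (pCons 0 q) i *\<^sub>C (D ^^ i) X) - (\<Sum>i\<le>Suc ?n. (l * coeff q i) *\<^sub>C (D ^^ i) X)"
    by (simp add: scale_left_diff_distrib algebra_simps flip: sum_subtractf del: sum.atMost_Suc)
  also have "(\<Sum>i\<le>Suc ?n. coeff (pCons 0 q) i *\<^sub>C (D ^^ i) X) = D (op_poly q X)"
    by (subst sum.atMost_Suc_shift) (simp add: op_poly_def D.sum D.scale)
  also have "(\<Sum>i\<le>Suc ?n. (l * coeff q i) *\<^sub>C (D ^^ i) X) = l *\<^sub>C op_poly q X"
    unfolding op_poly_bound[of q "Suc ?n", simplified] by (simp add: scale_sum_right algebra_simps)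
  finally show ?thesis by (simp add: shift_def)
qed

lemma span_gen_eigs_op_poly:
  assumes "p \<noteq> 0" "op_poly p X \<in> span gen_eigs" shows "X \<in> span gen_eigs"
  using assms
proof (induction "degree p" arbitrary: p)
  case 0
  then obtain c where "p = [:c:]" "c \<noteq> 0" using degree_0_id by (metis pCons_0_0)
  then have "X = inverse c *\<^sub>C op_poly p X" by (simp add: op_poly_def)
  then show ?case using 0 span_scale by metis
next
  case (Suc n)
  then obtain l where "poly p l = 0" using alg_closed_imp_poly_has_root[of p] by auto
  then obtain q where q: "p = [:-l, 1:] * q" using poly_eq_0_iff_dvd by blast
  then have "q \<noteq> 0" using Suc by auto
  then have "degree p = Suc (degree q)" using q degree_mult_eq[of "[:-l, 1:]" q] by simp
  then show ?case
    using Suc \<open>q \<noteq> 0\<close> q span_gen_eigs_shift op_poly_linear_factor by (metis nat.inject)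
qed

text \<open>The vectors \<open>D\<^sup>i X\<close> with \<open>i\<close> up to the dimension are too many to be independent.  If two of them coincide, they do
  not form a set of that many elements, and the difference of two monomials is used instead.\<close>

lemma exists_annihilating_poly: "\<exists>p. p \<noteq> 0 \<and> op_poly p X = 0"
proof (cases "inj_on (\<lambda>i. (D ^^ i) X) {..card E}")
  case True
  let ?S = "(\<lambda>i. (D ^^ i) X) ` {..card E}"
  have "card ?S = Suc (card E)" using True by (simp add: card_image)
  then have "dependent ?S"
    using independent_card_le_dim[of ?S UNIV] by (metis dim_UNIV not_less_eq_eq order_refl subset_UNIV)
  then obtain u v where u: "v \<in> ?S" "u v \<noteq> 0" "(\<Sum>v\<in>?S. u v *\<^sub>C v) = 0"
    by (auto simp: dependent_finite)
  define p where "p = (\<Sum>i\<le>card E. monom (u ((D ^^ i) X)) i)"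
  have c: "coeff p i = (if i \<le> card E then u ((D ^^ i) X) else 0)" for i
    by (simp add: p_def coeff_sum)
  have "degree p \<le> card E" by (rule degree_le) (simp add: c)
  then have "op_poly p X = (\<Sum>i\<le>card E. u ((D ^^ i) X) *\<^sub>C (D ^^ i) X)"
    by (simp add: op_poly_bound c)
  also have "\<dots> = 0" using u(3) by (simp add: sum.reindex[OF True])
  finally have "op_poly p X = 0" .
  moreover have "p \<noteq> 0" using u(1,2) c by (metis (mono_tags, lifting) atMost_iff coeff_0 image_iff)
  ultimately show ?thesis by blast
next
  case False
  then obtain i j where ij: "(D ^^ i) X = (D ^^ j) X" "i < j"
    unfolding inj_on_def by (metis linorder_neqE_nat)
  define p where "p = monom (1::complex) j - monom 1 i"
  have c: "coeff p k = (if k = j then 1 else 0) - (if k = i then 1 else 0)" for k by (simp add: p_def)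
  have "degree p \<le> j" by (rule degree_le) (use ij c in auto)
  then have "op_poly p X = (\<Sum>k\<le>j. (if k = j then (D ^^ k) X else 0) - (if k = i then (D ^^ k) X else 0))"
    unfolding op_poly_bound[OF \<open>degree p \<le> j\<close>] c by (intro sum.cong) auto
  also have "\<dots> = 0" using ij by (simp add: sum_subtractf)
  finally have "op_poly p X = 0" .
  moreover have "p \<noteq> 0" using c[of j] ij by auto
  ultimately show ?thesis by blast
qed

text \<open>Every vector is annihilated by some polynomial in \<open>D\<close>, which splits into linear factors over the complex numbers.\<close>

lemma span_gen_eigs: "span gen_eigs = UNIV"
proof -
  have "X \<in> span gen_eigs" for X
    using exists_annihilating_poly[of X] span_gen_eigs_op_poly span_zero by metis
  then show ?thesis by auto
qed

lemma linear_resolvent_map: "Vector_Spaces.linear smul smul (\<lambda>X. z *\<^sub>C X - D X)"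
  by unfold_locales (auto simp: D.add D.scale algebra_simps scale_left_commute)

text \<open>If \<open>z\<close> differs from the eigenvalues of a finite spanning set of generalised eigenvectors, Neumann sums show that
  \<open>z - D\<close> is surjective.\<close>

lemma finite_spec: "finite spec"
proof -
  obtain T where T: "T \<subseteq> gen_eigs" "independent T" "gen_eigs \<subseteq> span T"
    using maximal_independent_subset by blast
  have UT: "span T = UNIV" using span_mono[OF T(3)] span_gen_eigs by (auto simp: span_span)
  have "\<forall>X\<in>T. \<exists>l n. (shift l ^^ n) X = 0" using T(1) by (auto simp: gen_eigs_def)
  then obtain l n where ln: "\<And>X. X \<in> T \<Longrightarrow> (shift (l X) ^^ n X) X = 0" by metis
  have "z \<notin> spec" if "z \<notin> l ` T" for z
  proof -
    interpret A: Vector_Spaces.linear smul smul "\<lambda>X. z *\<^sub>C X - D X" by (rule linear_resolvent_map)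
    let ?A = "\<lambda>X. z *\<^sub>C X - D X"
    have "T \<subseteq> range ?A"
    proof
      fix X assume "X \<in> T"
      then have "X = ?A (neumann (l X) (n X) z X)" using neumann_inverts[OF ln] that by fastforce
      then show "X \<in> range ?A" by blast
    qed
    moreover have "subspace (range ?A)" by (rule A.subspace_image) (rule subspace_UNIV)
    ultimately have "span T \<subseteq> range ?A" by (rule span_minimal)
    then have "surj ?A" using UT by auto
    then have "bij ?A" using linear_surj_imp_inj[OF linear_resolvent_map] by (auto simp: bij_def)
    then show ?thesis by (simp add: op_spectrum_def)
  qed
  then have "spec \<subseteq> l ` T" by blast
  then show ?thesis using finiteI_independent[OF T(2)] finite_surj by blast
qed

lemma eigenvalue_in_spec:
  assumes "shift l X = 0" "X \<noteq> 0" shows "l \<in> spec"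
proof -
  have "l *\<^sub>C X - D X = l *\<^sub>C 0 - D 0" using assms(1) by (simp add: shift_def D.zero)
  then show ?thesis using assms(2) unfolding op_spectrum_def bij_def inj_def by blast
qed

lemma gen_eigenvalue_in_spec:
  assumes "(shift l ^^ n) X = 0" "X \<noteq> 0" shows "l \<in> spec"
  using assms(1)
proof (induction n)
  case (Suc n)
  then show ?case using eigenvalue_in_spec[of l "(shift l ^^ n) X"] by auto
qed (use assms in auto)

lemma spec_eigenvector:
  assumes "l \<in> spec" obtains X where "shift l X = 0" "X \<noteq> 0"
proof -
  interpret A: Vector_Spaces.linear smul smul "\<lambda>X. l *\<^sub>C X - D X" by (rule linear_resolvent_map)
  have "\<not> inj (\<lambda>X. l *\<^sub>C X - D X)"
    using assms linear_inj_imp_surj[OF linear_resolvent_map] by (auto simp: op_spectrum_def bij_def)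
  then obtain X where "l *\<^sub>C X - D X = 0" "X \<noteq> 0" using A.inj_iff_eq_0 by blast
  then show thesis using that[of X] by (simp add: shift_def)
qed

text \<open>Statements that are linear in a vector need to be checked on generalised eigenvectors only.  The eigenvalue may be
  taken from the spectrum because the others contribute the zero vector alone.\<close>

lemma gen_eig_induct [case_names gen zero add scale]:
  assumes "\<And>l n X. l \<in> spec \<Longrightarrow> (shift l ^^ n) X = 0 \<Longrightarrow> P X"
    and "P 0" "\<And>X Y. P X \<Longrightarrow> P Y \<Longrightarrow> P (X + Y)" "\<And>c X. P X \<Longrightarrow> P (c *\<^sub>C X)"
  shows "P X"
proof -
  have "X \<in> span gen_eigs" by (simp add: span_gen_eigs)
  then show ?thesis
  proof (induction rule: span_induct_alt)
    case (step c X Y)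
    then obtain l n where "(shift l ^^ n) X = 0" by (auto simp: gen_eigs_def)
    then have "P X" using assms(1,2) gen_eigenvalue_in_spec by (cases "X = 0") blast+
    then show ?case using assms(3,4) step by blast
  qed (rule assms)
qed

lemma bij_resolvent_map: "z \<notin> spec \<Longrightarrow> bij (\<lambda>X. z *\<^sub>C X - D X)"
  by (simp add: op_spectrum_def)

lemma resolvent_left: "z \<notin> spec \<Longrightarrow> res z (z *\<^sub>C X - D X) = X"
  unfolding resolvent_def by (rule inv_f_f[OF bij_is_inj[OF bij_resolvent_map]])

lemma resolvent_right: "z \<notin> spec \<Longrightarrow> z *\<^sub>C res z X - D (res z X) = X"
  unfolding resolvent_def by (rule surj_f_inv_f[OF bij_is_surj[OF bij_resolvent_map]])

lemma linear_resolvent: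
  assumes z: "z \<notin> spec" shows "Vector_Spaces.linear smul smul (res z)"
proof unfold_locales
  show "res z (X + Y) = res z X + res z Y" for X Y
    using resolvent_left[OF z, of "res z X + res z Y"] resolvent_right[OF z, of X] resolvent_right[OF z, of Y]
    by (simp add: D.add algebra_simps)
  show "res z (c *\<^sub>C X) = c *\<^sub>C res z X" for c X
  proof -
    have "z *\<^sub>C c *\<^sub>C res z X - D (c *\<^sub>C res z X) = c *\<^sub>C (z *\<^sub>C res z X - D (res z X))"
      by (simp only: D.scale scale_right_diff_distrib scale_left_commute[of z c])
    then show ?thesis
      using resolvent_left[OF z, of "c *\<^sub>C res z X"] by (simp only: resolvent_right[OF z])
  qed
qed

lemma
  assumes "z \<notin> spec"
  shows resolvent_add: "res z (X + Y) = res z X + res z Y"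
    and resolvent_diff: "res z (X - Y) = res z X - res z Y"
    and resolvent_scale: "res z (c *\<^sub>C X) = c *\<^sub>C res z X"
    and resolvent_zero: "res z 0 = 0"
proof -
  interpret r: Vector_Spaces.linear smul smul "res z" using linear_resolvent[OF assms] .
  show "res z (X + Y) = res z X + res z Y" "res z (X - Y) = res z X - res z Y"
    "res z (c *\<^sub>C X) = c *\<^sub>C res z X" "res z 0 = 0"
    by (rule r.add r.diff r.scale r.zero)+
qed

lemma resolvent_gen_eig:
  assumes "z \<notin> spec" "l \<in> spec" "(shift l ^^ n) X = 0"
  shows "res z X = neumann l n z X"
  using resolvent_left[OF assms(1), of "neumann l n z X"] neumann_inverts[OF assms(3), of z] assms(1,2)
  by metis

end

section \<open>The Dunford integral as a sum of residues\<close>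

context fd_operator
begin

lemma vholo_resolvent_vector: "vholo (- spec) (\<lambda>z. res z X)"
proof (induction X rule: gen_eig_induct)
  case (gen l n X)
  have "vholo (- spec) (\<lambda>z. neumann l n z X)"
    unfolding neumann_def using gen
    by (intro vholo_sum vholo_scale vholo_const) (auto intro!: holomorphic_intros)
  then show ?case by (subst vholo_cong[of _ _ "\<lambda>z. neumann l n z X"]) (use resolvent_gen_eig gen in auto)
next
  case zero
  show ?case by (subst vholo_cong[of _ _ "\<lambda>z. 0"]) (auto simp: resolvent_zero)
next
  case (add X Y)
  then show ?case
    by (subst vholo_cong[of _ _ "\<lambda>z. res z X + res z Y"])
       (auto intro: vholo_add simp: resolvent_add)
next
  case (scale c X)
  then show ?case
    by (subst vholo_cong[of _ _ "\<lambda>z. c *\<^sub>C res z X"])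
       (auto intro: vholo_scale simp: resolvent_scale)
qed

lemma vholo_resolvent: "vholo (- spec) F \<Longrightarrow> vholo (- spec) (\<lambda>z. res z (F z))"
  by (rule vholo_operator_family) (auto intro: linear_resolvent vholo_resolvent_vector)

text \<open>On a generalised eigenvector the resolvent is a polynomial in \<open>(z - l)\<^sup>-\<^sup>1\<close>, so it stays bounded on the entire
  complement of an \<open>\<epsilon>\<close>-neighbourhood of the spectrum, including near infinity.\<close>

lemma resolvent_bounded:
  assumes "0 < \<epsilon>"
  obtains B where "0 \<le> B"
    "\<And>z X. (\<And>l. l \<in> spec \<Longrightarrow> \<epsilon> \<le> dist z l) \<Longrightarrow> nrm (res z X) \<le> B * nrm X"
proof -
  let ?I = "{z. \<forall>l\<in>spec. \<epsilon> \<le> dist z l}"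
  have off: "z \<notin> spec" if "z \<in> ?I" for z
    using that assms by force
  note lin = linear_resolvent[OF off]
  have "\<exists>B. \<forall>z\<in>?I. nrm (res z X) \<le> B" for X
  proof (induction X rule: gen_eig_induct)
    case (gen l n X)
    have "nrm (res z X) \<le> (\<Sum>k<n. inverse \<epsilon> ^ Suc k * nrm ((shift l ^^ k) X))" if z: "z \<in> ?I" for z
    proof -
      have "cmod (inverse (z - l)) \<le> inverse \<epsilon>"
        using z gen(1) assms by (auto simp: norm_inverse dist_norm intro!: le_imp_inverse_le)
      then have "cmod (inverse (z - l) ^ Suc k) \<le> inverse \<epsilon> ^ Suc k" for k
        unfolding norm_power by (intro power_mono) auto
      then have "nrm ((inverse (z - l) ^ Suc k) *\<^sub>C (shift l ^^ k) X) \<le> inverse \<epsilon> ^ Suc k * nrm ((shift l ^^ k) X)" for k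
        unfolding nrm_scale by (intro mult_right_mono nrm_nonneg)
      then show ?thesis
        unfolding resolvent_gen_eig[OF off[OF z] gen] neumann_def
        by (intro order_trans[OF nrm_sum] sum_mono)
    qed
    then show ?case by blast
  next
    case zero
    show ?case by (intro exI[of _ 0]) (auto simp: nrm_def resolvent_zero[OF off] crd.zero)
  next
    case (add X Y)
    then obtain B C where "\<forall>z\<in>?I. nrm (res z X) \<le> B" "\<forall>z\<in>?I. nrm (res z Y) \<le> C" by blast
    then have "\<forall>z\<in>?I. nrm (res z (X + Y)) \<le> B + C"
      by (simp add: resolvent_add[OF off]) (meson add_mono nrm_add order_trans)
    then show ?case by blast
  next
    case (scale c X)
    then obtain B where "\<forall>z\<in>?I. nrm (res z X) \<le> B" by blast
    then have "\<forall>z\<in>?I. nrm (res z (c *\<^sub>C X)) \<le> cmod c * B"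
      by (auto simp: resolvent_scale[OF off] nrm_scale intro!: mult_left_mono)
    then show ?case by blast
  qed
  from linear_family_bounded[of ?I res, OF lin this]
  obtain B where "0 \<le> B" "\<And>z X. z \<in> ?I \<Longrightarrow> nrm (res z X) \<le> B * nrm X"
    by blast
  then show thesis using that by blast
qed

end

text \<open>The set \<open>K'\<close> may be any set inside the discs.  This is used for the spectrum itself and for the spectra of
  nearby operators, which are thus encircled by the same circles.\<close>

lemma circles_encircle:
  assumes K: "set ps = K" "distinct ps" and \<epsilon>: "0 < \<epsilon>"
    and U: "\<And>p. p \<in> K \<Longrightarrow> cball p \<epsilon> \<subseteq> U"
    and sep: "\<And>p q. p \<in> K \<Longrightarrow> q \<in> K \<Longrightarrow> p \<noteq> q \<Longrightarrow> 2 * \<epsilon> \<le> dist p q"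
    and K': "K' \<subseteq> (\<Union>p\<in>K. ball p \<epsilon>)"
  shows "encircles U K' (map (\<lambda>p. circlepath p \<epsilon>) ps)"
proof -
  have close: "p = q" if "p \<in> K" "q \<in> K" "z \<in> ball p \<epsilon>" "z \<in> cball q \<epsilon>" for p q z
    using sep[OF that(1,2)] that(3,4) dist_triangle[of p q z] by (auto simp: dist_commute)
  have out: "winding_number (circlepath p \<epsilon>) z = 0" if "z \<notin> cball p \<epsilon>" for p z
    using \<epsilon> that by (intro winding_number_zero_outside[of _ "cball p \<epsilon>"]) auto
  have sum: "(\<Sum>\<gamma>\<leftarrow>map (\<lambda>p. circlepath p \<epsilon>) ps. winding_number \<gamma> z)
      = (\<Sum>p\<in>K. winding_number (circlepath p \<epsilon>) z)" for z
    using K by (simp add: sum_list_distinct_conv_sum_set o_def)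
  have image: "path_image (circlepath p \<epsilon>) \<subseteq> U - K'" if p: "p \<in> K" for p
  proof
    fix z assume "z \<in> path_image (circlepath p \<epsilon>)"
    then have z: "dist p z = \<epsilon>" using \<epsilon> by auto
    have "z \<notin> K'"
    proof
      assume "z \<in> K'"
      then obtain q where "q \<in> K" "z \<in> ball q \<epsilon>" using K' by auto
      then show False using close[of q p z] p z by auto
    qed
    then show "z \<in> U - K'" using U[OF p] z by auto
  qed
  have one: "(\<Sum>p\<in>K. winding_number (circlepath p \<epsilon>) z) = 1" if "z \<in> K'" for z
  proof -
    obtain p where p: "p \<in> K" "z \<in> ball p \<epsilon>" using K' \<open>z \<in> K'\<close> by auto
    have "winding_number (circlepath q \<epsilon>) z = (if q = p then 1 else 0)" if q: "q \<in> K" for q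
    proof (cases "q = p")
      case True
      then show ?thesis using p(2) by (simp add: winding_number_circlepath dist_norm norm_minus_commute)
    next
      case False
      then show ?thesis using close[OF p(1) q p(2)] out[of z q] by auto
    qed
    moreover have "finite K" using K(1) by auto
    ultimately show ?thesis using p(1) by (simp cong: sum.cong)
  qed
  have zero: "(\<Sum>p\<in>K. winding_number (circlepath p \<epsilon>) z) = 0" if "z \<notin> U" for z
    using out U that by (intro sum.neutral) blast
  show ?thesis
    unfolding encircles_def sum using K image one zero by auto
qed

lemma exists_separating_radius:
  fixes K U :: "complex set"
  assumes "finite K" "open U" "K \<subseteq> U"
  obtains \<epsilon> where "0 < \<epsilon>" "\<And>p. p \<in> K \<Longrightarrow> cball p \<epsilon> \<subseteq> U"
    "\<And>p q. p \<in> K \<Longrightarrow> q \<in> K \<Longrightarrow> p \<noteq> q \<Longrightarrow> 2 * \<epsilon> \<le> dist p q"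
proof -
  have "\<exists>r>0. cball p r \<subseteq> U \<and> (\<forall>q\<in>K. q \<noteq> p \<longrightarrow> 2 * r \<le> dist p q)" if p: "p \<in> K" for p
  proof -
    obtain r where r: "0 < r" "cball p r \<subseteq> U" using assms p open_contains_cball by blast
    obtain d where d: "0 < d" "\<forall>q\<in>K. q \<noteq> p \<longrightarrow> d \<le> dist p q"
      using finite_set_avoid[OF assms(1)] by blast
    show ?thesis
      by (rule exI[of _ "min r (d / 2)"]) (use r d in auto)
  qed
  then obtain r where r: "\<And>p. p \<in> K \<Longrightarrow> 0 < r p \<and> cball p (r p) \<subseteq> U \<and> (\<forall>q\<in>K. q \<noteq> p \<longrightarrow> 2 * r p \<le> dist p q)"
    by metis
  \<comment> \<open>the element 1 takes care of empty \<open>K\<close>\<close>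
  define \<epsilon> where "\<epsilon> = Min (insert 1 (r ` K))"
  have le: "\<epsilon> \<le> r p" if "p \<in> K" for p using that assms(1) by (simp add: \<epsilon>_def)
  show thesis
  proof
    show "0 < \<epsilon>" using assms(1) r by (simp add: \<epsilon>_def)
    show "cball p \<epsilon> \<subseteq> U" if "p \<in> K" for p using r[OF that] le[OF that] by force
    show "2 * \<epsilon> \<le> dist p q" if "p \<in> K" "q \<in> K" "p \<noteq> q" for p q
      using r[OF that(1)] le[OF that(1)] that by force
  qed
qed

text \<open>The domain \<open>U\<close> may miss only finitely many points of each disc; this is the setting of the residue theorem for
  cycles.\<close>

locale fd_calculus = fd_operator smul E D + residue_functional f U "op_spectrum smul D"
  for smul :: "complex \<Rightarrow> 'g \<Rightarrow> 'g::ab_group_add" (infixr "*\<^sub>C" 75) and E D f U +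
  assumes locally_finite_complement: "\<And>r. finite (cball 0 r - U)"
begin

definition vL :: "(complex \<Rightarrow> 'g) \<Rightarrow> 'g"
  where "vL F = (\<Sum>b\<in>E. L (\<lambda>z. crd (F z) b) *\<^sub>C b)"

lemma crd_vL: "b \<in> E \<Longrightarrow> crd (vL F) b = L (\<lambda>z. crd (F z) b)"
  unfolding vL_def by (rule crd_sum_basis)

text \<open>Linear maps may be taken inside the integral.  The integrand has to be holomorphic off the spectrum, since
  the residue functional is linear only there.\<close>

lemma functional_vL:
  assumes \<phi>: "Vector_Spaces.linear smul (*) \<phi>" and F: "vholo (- spec) F"
  shows "\<phi> (vL F) = L (\<lambda>z. \<phi> (F z))"
proof -
  have h: "(\<lambda>z. crd (F z) b) holomorphic_on - spec" if "b \<in> E" for b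
    using F that by (simp add: vholo_def)
  have "L (\<lambda>z. \<phi> (F z)) = L (\<lambda>z. \<Sum>b\<in>E. \<phi> b * crd (F z) b)"
    unfolding functional_expand[OF \<phi>, of "F _"] by (simp add: mult.commute)
  also have "\<dots> = (\<Sum>b\<in>E. \<phi> b * L (\<lambda>z. crd (F z) b))"
    by (subst L_sum) (auto intro!: holomorphic_intros h sum.cong L_cmult)
  also have "\<dots> = \<phi> (vL F)"
    unfolding functional_expand[OF \<phi>, of "vL F"] by (auto intro!: sum.cong simp: crd_vL)
  finally show ?thesis ..
qed

lemma operator_vL:
  assumes A: "Vector_Spaces.linear smul smul A" and F: "vholo (- spec) F"
  shows "A (vL F) = vL (\<lambda>z. A (F z))"
proof (rule crd_eqI)
  fix b assume b: "b \<in> E"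
  have "Vector_Spaces.linear smul (*) (\<lambda>X. crd (A X) b)"
    using Vector_Spaces.linear_compose[OF A linear_crd] by (simp add: o_def)
  from functional_vL[OF this F] show "crd (A (vL F)) b = crd (vL (\<lambda>z. A (F z))) b"
    by (simp add: crd_vL[OF b])
qed

lemma vL_cong: "(\<And>z. z \<notin> spec \<Longrightarrow> F z = G z) \<Longrightarrow> vL F = vL G"
  unfolding vL_def by (intro sum.cong refl arg_cong2[of _ _ _ _ smul] L_cong) simp

lemma vL_add: "vholo (- spec) F \<Longrightarrow> vholo (- spec) G \<Longrightarrow> vL (\<lambda>z. F z + G z) = vL F + vL G"
  by (rule crd_eqI) (simp add: crd_vL crd.add L_add vholo_def)

lemma vL_scale: "vholo (- spec) F \<Longrightarrow> vL (\<lambda>z. c *\<^sub>C F z) = c *\<^sub>C vL F"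
  by (rule crd_eqI) (simp add: crd_vL crd.scale L_cmult vholo_def)

lemma vL_diff: "vholo (- spec) F \<Longrightarrow> vholo (- spec) G \<Longrightarrow> vL (\<lambda>z. F z - G z) = vL F - vL G"
  by (rule crd_eqI) (simp add: crd_vL crd.diff L_diff vholo_def)

lemma vL_minus: "vholo (- spec) F \<Longrightarrow> vL (\<lambda>z. - F z) = - vL F"
  by (rule crd_eqI) (simp add: crd_vL crd.neg L_minus vholo_def)

definition calc :: "'g \<Rightarrow> 'g"
  where "calc X = vL (\<lambda>z. res z X)"

lemma linear_calc: "Vector_Spaces.linear smul smul calc"
proof unfold_locales
  show "calc (X + Y) = calc X + calc Y" for X Y
    unfolding calc_def vL_add[OF vholo_resolvent_vector vholo_resolvent_vector, symmetric]
    by (rule vL_cong) (simp add: resolvent_add)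
  show "calc (c *\<^sub>C X) = c *\<^sub>C calc X" for c X
    unfolding calc_def vL_scale[OF vholo_resolvent_vector, symmetric]
    by (rule vL_cong) (simp add: resolvent_scale)
qed

lemma calc_gen_eig:
  assumes "l \<in> spec" "(shift l ^^ n) X = 0"
  shows "calc X = (\<Sum>k<n. fps_nth (fps_expansion f l) k *\<^sub>C (shift l ^^ k) X)"
proof (rule crd_eqI)
  fix b assume b: "b \<in> E"
  have "crd (calc X) b = L (\<lambda>z. crd (neumann l n z X) b)"
    unfolding calc_def crd_vL[OF b] by (rule L_cong) (simp add: resolvent_gen_eig[OF _ assms])
  also have "\<dots> = L (\<lambda>z. \<Sum>k<n. crd ((shift l ^^ k) X) b * inverse (z - l) ^ Suc k)"
    by (simp add: neumann_def crd.sum crd.scale mult.commute)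
  also have "\<dots> = (\<Sum>k<n. crd ((shift l ^^ k) X) b * L (\<lambda>z. inverse (z - l) ^ Suc k))"
    using holomorphic_pole_power[OF assms(1)]
    by (simp only: L_sum[of "{..<n}"] L_cmult holomorphic_on_mult holomorphic_on_const)
  also have "\<dots> = crd (\<Sum>k<n. fps_nth (fps_expansion f l) k *\<^sub>C (shift l ^^ k) X) b"
    unfolding L_power[OF assms(1)] by (simp add: crd.sum crd.scale mult.commute)
  finally show "crd (calc X) b = \<dots>" .
qed

lemma contour_integral_L:
  assumes "encircles U spec C" "h holomorphic_on - spec"
  shows "(\<Sum>\<gamma>\<leftarrow>C. contour_integral \<gamma> (\<lambda>z. f z * h z)) = 2 * of_real pi * \<i> * L h"
  unfolding residue_sum_def
  by (rule cycle_residue_theorem[OF locally_finite_complement finite_poles _ assms(1)])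
     (intro holomorphic_on_mult holomorphic_on_subset[OF holo] holomorphic_on_subset[OF assms(2)]; auto)

lemma crd_dunford:
  assumes "b \<in> E"
  shows "crd (dunford_integral smul E f D C X) b
    = (\<Sum>\<gamma>\<leftarrow>C. contour_integral \<gamma> (\<lambda>z. f z * crd (res z X) b)) / (2 * of_real pi * \<i>)"
  unfolding dunford_integral_def vec_contour_integral_def
  by (simp add: crd.scale crd_sum_basis[OF assms])

lemma dunford_eq_calc:
  assumes "encircles U spec C"
  shows "dunford_integral smul E f D C = calc"
proof (rule ext, rule crd_eqI)
  fix X b assume b: "b \<in> E"
  have h: "(\<lambda>z. crd (res z X) b) holomorphic_on - spec"
    using vholo_resolvent_vector b by (simp add: vholo_def)
  show "crd (dunford_integral smul E f D C X) b = crd (calc X) b"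
    unfolding crd_dunford[OF b] contour_integral_L[OF assms h] calc_def crd_vL[OF b] by simp
qed

lemma exists_encircling: "\<exists>C. encircles U spec C"
proof -
  obtain \<epsilon> where \<epsilon>: "0 < \<epsilon>" "\<And>p. p \<in> spec \<Longrightarrow> cball p \<epsilon> \<subseteq> U"
    "\<And>p q. p \<in> spec \<Longrightarrow> q \<in> spec \<Longrightarrow> p \<noteq> q \<Longrightarrow> 2 * \<epsilon> \<le> dist p q"
    using exists_separating_radius[OF finite_spec open_dom poles_dom] by metis
  obtain ps where "set ps = spec" "distinct ps" using finite_distinct_list[OF finite_spec] by blast
  moreover have "spec \<subseteq> (\<Union>p\<in>spec. ball p \<epsilon>)" using \<epsilon>(1) by auto
  ultimately show ?thesis using circles_encircle[OF _ _ \<epsilon>] by blast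
qed

lemma functional_calculus_eq_calc: "functional_calculus smul E U f D = calc"
  unfolding functional_calculus_def
  using exists_encircling dunford_eq_calc by (intro the_equality) auto

end

section \<open>Differentiating the functional calculus\<close>

lemma has_field_derivative_quadratic_bound:
  fixes g :: "complex \<Rightarrow> complex"
  assumes "0 < \<delta>" and bd: "\<And>t. norm t < \<delta> \<Longrightarrow> norm (g t - g 0 - t * d) \<le> c * norm t ^ 2"
  shows "(g has_field_derivative d) (at 0)"
proof -
  have "((\<lambda>t. (g t - g 0) / t - d) \<longlongrightarrow> 0) (at 0)"
  proof (rule Lim_null_comparison)
    show "\<forall>\<^sub>F t in at 0. norm ((g t - g 0) / t - d) \<le> c * norm t"
      unfolding eventually_at
    proof (intro exI[of _ \<delta>] conjI ballI impI)
      fix t :: complex assume t: "t \<noteq> 0 \<and> dist t 0 < \<delta>"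
      then have "(g t - g 0) / t - d = (g t - g 0 - t * d) / t" by (simp add: field_simps)
      then have "norm ((g t - g 0) / t - d) = norm (g t - g 0 - t * d) / norm t"
        by (simp add: norm_divide)
      also have "\<dots> \<le> c * norm t ^ 2 / norm t" using bd[of t] t by (intro divide_right_mono) auto
      finally show "norm ((g t - g 0) / t - d) \<le> c * norm t" using t by (simp add: power2_eq_square)
    qed (use assms in auto)
    have "((\<lambda>t::complex. c * norm t) \<longlongrightarrow> c * norm (0::complex)) (at 0)"
      by (rule tendsto_mult[OF tendsto_const tendsto_norm[OF tendsto_ident_at]])
    then show "((\<lambda>t. c * norm t) \<longlongrightarrow> 0) (at (0::complex))" by simp
  qed
  then have "((\<lambda>t. (g t - g 0) / t) \<longlongrightarrow> d) (at 0)" by (simp add: LIM_zero_iff)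
  then show ?thesis by (simp add: has_field_derivative_iff)
qed

lemma norm_sum_list_le: "norm (\<Sum>x\<leftarrow>xs. h x) \<le> (\<Sum>x\<leftarrow>xs. norm (h x :: 'a::real_normed_vector))"
  by (induction xs) (auto intro: norm_triangle_le)

context fd_operator
begin

lemma fd_operator_perturbed:
  assumes "Vector_Spaces.linear smul smul A"
  shows "fd_operator smul E (\<lambda>X. D X + t *\<^sub>C A X)"
proof -
  interpret A: Vector_Spaces.linear smul smul A by fact
  show ?thesis
    by unfold_locales (auto simp: D.add D.scale A.add A.scale algebra_simps scale_left_commute)
qed

text \<open>At distance \<open>\<epsilon>\<close> or more from the spectrum of \<open>D\<close>, the resolvent is bounded by \<open>B\<close>.  When \<open>t\<close> is so small that
  \<open>t (res z) A\<close> has norm at most 1/2, an eigenvector \<open>X = t (res z) A X\<close> of \<open>D + t A\<close> must vanish, and the vector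
  \<open>W = (z - D - t A)\<^sup>-\<^sup>1 Y\<close> satisfies \<open>W = res z Y + t res z (A W)\<close>.  Iterating this equation once more gives the first
  order expansion with a quadratic remainder.\<close>

lemma perturbed_resolvent:
  assumes A: "Vector_Spaces.linear smul smul A" and \<epsilon>: "0 < \<epsilon>"
  obtains \<delta> c where "0 < \<delta>" "0 \<le> c"
    "\<forall>t z. norm t < \<delta> \<longrightarrow> (\<forall>l\<in>spec. \<epsilon> \<le> dist z l) \<longrightarrow> z \<notin> op_spectrum smul (\<lambda>X. D X + t *\<^sub>C A X)"
    "\<forall>t z Y. norm t < \<delta> \<longrightarrow> (\<forall>l\<in>spec. \<epsilon> \<le> dist z l) \<longrightarrow>
      nrm (resolvent smul (\<lambda>X. D X + t *\<^sub>C A X) z Y - res z Y - t *\<^sub>C res z (A (res z Y))) \<le> c * norm t ^ 2 * nrm Y"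
proof -
  interpret A: Vector_Spaces.linear smul smul A by fact
  obtain B where B: "0 \<le> B"
    "\<And>z X. (\<And>l. l \<in> spec \<Longrightarrow> \<epsilon> \<le> dist z l) \<Longrightarrow> nrm (res z X) \<le> B * nrm X"
    using resolvent_bounded[OF \<epsilon>] by blast
  have "\<exists>B. \<forall>i\<in>(UNIV::unit set). nrm (A X) \<le> B" for X by blast
  then obtain C where C: "0 \<le> C" "\<And>X. nrm (A X) \<le> C * nrm X"
    using linear_family_bounded[of "UNIV::unit set" "\<lambda>_. A"] A by (metis UNIV_I)
  define M where "M = B * C"
  have M: "0 \<le> M" using B C by (simp add: M_def)
  \<comment> \<open>\<open>M + 1\<close> instead of \<open>M\<close>, because \<open>M\<close> may be 0\<close>
  define \<delta> where "\<delta> = 1 / (2 * (M + 1))"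
  have \<delta>: "0 < \<delta>" using M by (simp add: \<delta>_def)
  have tM: "norm t * M \<le> 1/2" if "norm t < \<delta>" for t :: complex
  proof -
    have "norm t * M \<le> \<delta> * (M + 1)" using that M \<delta> by (intro mult_mono) auto
    also have "\<delta> * (M + 1) = 1/2" using M by (simp add: \<delta>_def)
    finally show ?thesis .
  qed
  have resA: "nrm (res z (A X)) \<le> M * nrm X" if "\<And>l. l \<in> spec \<Longrightarrow> \<epsilon> \<le> dist z l" for z X
    using order_trans[OF B(2)[OF that] mult_left_mono[OF C(2) B(1)]] by (simp add: M_def mult.assoc)
  have off: "z \<notin> spec" if "\<And>l. l \<in> spec \<Longrightarrow> \<epsilon> \<le> dist z l" for z
    using that \<epsilon> by force
  have notspec: "z \<notin> op_spectrum smul (\<lambda>X. D X + t *\<^sub>C A X)"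
    if t: "norm t < \<delta>" and z: "\<And>l. l \<in> spec \<Longrightarrow> \<epsilon> \<le> dist z l" for t z
  proof
    interpret P: fd_operator smul E "\<lambda>X. D X + t *\<^sub>C A X" by (rule fd_operator_perturbed[OF A])
    assume "z \<in> P.spec"
    then obtain X where X: "P.shift z X = 0" "X \<noteq> 0" by (rule P.spec_eigenvector)
    then have "z *\<^sub>C X - D X = t *\<^sub>C A X" by (simp add: P.shift_def algebra_simps)
    then have "X = t *\<^sub>C res z (A X)"
      using resolvent_left[OF off[OF z], of X] by (simp add: resolvent_scale[OF off[OF z]])
    then have "nrm X = norm t * nrm (res z (A X))" using nrm_scale by metis
    also have "\<dots> \<le> norm t * (M * nrm X)" by (intro mult_left_mono resA z) auto
    also have "\<dots> \<le> 1/2 * nrm X" using mult_right_mono[OF tM[OF t] nrm_nonneg[of X]] by (simp add: mult.assoc)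
    finally have "nrm X = 0" using nrm_nonneg[of X] by linarith
    then show False using X nrm_eq_0 by blast
  qed
  moreover have "nrm (resolvent smul (\<lambda>X. D X + t *\<^sub>C A X) z Y - res z Y - t *\<^sub>C res z (A (res z Y)))
      \<le> (M * M * (2 * B)) * norm t ^ 2 * nrm Y"
    if t: "norm t < \<delta>" and z: "\<And>l. l \<in> spec \<Longrightarrow> \<epsilon> \<le> dist z l" for t z Y
  proof -
    interpret P: fd_operator smul E "\<lambda>X. D X + t *\<^sub>C A X" by (rule fd_operator_perturbed[OF A])
    note zs = off[OF z]
    define W where "W = P.res z Y"
    have "z *\<^sub>C W - D W = Y + t *\<^sub>C A W"
      using P.resolvent_right[OF notspec[OF t z]] by (simp add: W_def algebra_simps)
    then have W: "W = res z Y + t *\<^sub>C res z (A W)"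
      using resolvent_left[OF zs, of W] by (simp add: resolvent_add[OF zs] resolvent_scale[OF zs])
    have "nrm W \<le> nrm (res z Y) + norm t * nrm (res z (A W))"
      using nrm_add[of "res z Y" "t *\<^sub>C res z (A W)"] W by (simp add: nrm_scale)
    also have "\<dots> \<le> B * nrm Y + norm t * (M * nrm W)"
      by (intro add_mono mult_left_mono resA B(2) z) auto
    also have "norm t * (M * nrm W) \<le> 1/2 * nrm W"
      using mult_right_mono[OF tM[OF t] nrm_nonneg[of W]] by (simp add: mult.assoc)
    finally have Wb: "nrm W \<le> 2 * B * nrm Y" by simp
    have "W - res z Y - t *\<^sub>C res z (A (res z Y)) = t *\<^sub>C res z (A (W - res z Y))"
      using W by (simp add: A.diff resolvent_diff[OF zs] algebra_simps)
    also have "res z (A (W - res z Y)) = t *\<^sub>C res z (A (res z (A W)))"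
    proof -
      have "W - res z Y = t *\<^sub>C res z (A W)" using W by (simp add: algebra_simps)
      then show ?thesis by (simp only: A.scale resolvent_scale[OF zs])
    qed
    finally have eq: "W - res z Y - t *\<^sub>C res z (A (res z Y)) = (t * t) *\<^sub>C res z (A (res z (A W)))"
      by simp
    have "nrm (res z (A (res z (A W)))) \<le> M * (M * (2 * B * nrm Y))"
      using M by (intro order_trans[OF resA[OF z]] mult_left_mono order_trans[OF resA[OF z]] Wb)
    then show ?thesis
      unfolding W_def[symmetric] eq nrm_scale norm_mult
      using mult_left_mono[of _ _ "norm t * norm t"] by (fastforce simp: power2_eq_square mult_ac)
  qed
  moreover have "0 \<le> M * M * (2 * B)" using M B by simp
  ultimately show thesis by (intro that[OF \<delta>]) blast+
qed

end

context fd_calculus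
begin

text \<open>For all small \<open>t\<close> the perturbed spectrum lies in small discs around that of \<open>D\<close>, so both Dunford integrals
  can be taken over the same circles and the expansion of the resolvent can be integrated term by term.\<close>

lemma has_field_derivative_calculus:
  assumes A: "Vector_Spaces.linear smul smul A" and b: "b \<in> E"
  shows "((\<lambda>t. crd (functional_calculus smul E U f (\<lambda>X. D X + t *\<^sub>C A X) Y) b)
    has_field_derivative crd (vL (\<lambda>z. res z (A (res z Y)))) b) (at 0)"
proof -
  let ?D = "\<lambda>t X. D X + t *\<^sub>C A X"
  obtain \<epsilon> where \<epsilon>: "0 < \<epsilon>" "\<And>p. p \<in> spec \<Longrightarrow> cball p \<epsilon> \<subseteq> U"
    "\<And>p q. p \<in> spec \<Longrightarrow> q \<in> spec \<Longrightarrow> p \<noteq> q \<Longrightarrow> 2 * \<epsilon> \<le> dist p q"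
    using exists_separating_radius[OF finite_spec open_dom poles_dom] by metis
  obtain ps where ps: "set ps = spec" "distinct ps" using finite_distinct_list[OF finite_spec] by blast
  define C where "C = map (\<lambda>p. circlepath p \<epsilon>) ps"
  obtain \<delta> c where \<delta>: "0 < \<delta>" and c: "0 \<le> c"
    and off: "\<forall>t z. norm t < \<delta> \<longrightarrow> (\<forall>l\<in>spec. \<epsilon> \<le> dist z l) \<longrightarrow> z \<notin> op_spectrum smul (?D t)"
    and rem: "\<forall>t z Y. norm t < \<delta> \<longrightarrow> (\<forall>l\<in>spec. \<epsilon> \<le> dist z l) \<longrightarrow>
      nrm (resolvent smul (?D t) z Y - res z Y - t *\<^sub>C res z (A (res z Y))) \<le> c * norm t ^ 2 * nrm Y"
    by (rule perturbed_resolvent[OF A \<epsilon>(1)])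
  \<comment> \<open>the circle around \<open>p\<close> keeps the distance \<open>\<epsilon>\<close> from the other eigenvalues as well, because they are \<open>2 \<epsilon>\<close> apart\<close>
  have on_circle: "\<epsilon> \<le> dist z l" if "l \<in> spec" "p \<in> spec" "dist p z = \<epsilon>" for l p z
    using \<epsilon>(3)[OF that(1,2)] that(3) dist_triangle[of l p z] by (cases "l = p") (auto simp: dist_commute)
  define S where "S = (\<Union>p\<in>spec. sphere p \<epsilon>)"
  have S: "\<epsilon> \<le> dist z l" if "z \<in> S" "l \<in> spec" for z l
    using on_circle that by (auto simp: S_def)
  have SU: "S \<subseteq> U" using \<epsilon>(2) by (force simp: S_def)
  have "compact S" unfolding S_def using finite_spec by (intro compact_UN) auto
  moreover have "continuous_on S f"
    using holomorphic_on_imp_continuous_on[OF holo] SU by (rule continuous_on_subset)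
  ultimately have "bounded (f ` S)" by (intro compact_imp_bounded compact_continuous_image)
  then obtain m where m: "0 < m" "\<And>z. z \<in> S \<Longrightarrow> norm (f z) \<le> m"
    by (auto simp: bounded_pos)
  let ?g = "\<lambda>t. crd (functional_calculus smul E U f (?D t) Y) b"
  let ?G = "\<lambda>t z. crd (resolvent smul (?D t) z Y) b"
  let ?H = "\<lambda>z. crd (res z (A (res z Y))) b"
  have vh: "vholo (- spec) (\<lambda>z. res z (A (res z Y)))"
    by (intro vholo_resolvent vholo_operator[OF A] vholo_resolvent_vector)
  have g: "2 * of_real pi * \<i> * ?g t = (\<Sum>\<gamma>\<leftarrow>C. contour_integral \<gamma> (\<lambda>z. f z * ?G t z))"
    and Gcont: "continuous_on S (\<lambda>z. f z * ?G t z)" if t: "norm t < \<delta>" for t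
  proof -
    interpret P: fd_operator smul E "?D t" by (rule fd_operator_perturbed[OF A])
    have Pspec: "P.spec \<subseteq> (\<Union>p\<in>spec. ball p \<epsilon>)"
    proof
      fix z assume "z \<in> P.spec"
      then obtain l where "l \<in> spec" "\<not> \<epsilon> \<le> dist z l" using off t by blast
      then show "z \<in> (\<Union>p\<in>spec. ball p \<epsilon>)" by (auto simp: dist_commute not_le)
    qed
    interpret P: fd_calculus smul E "?D t" f U
    proof unfold_locales
      show "P.spec \<subseteq> U" using Pspec \<epsilon>(2) by (meson UN_least ball_subset_cball order_trans)
    qed (use open_dom holo locally_finite_complement P.finite_spec in auto)
    have enc: "encircles U P.spec C"
      unfolding C_def by (rule circles_encircle[OF ps \<epsilon> Pspec])
    show "2 * of_real pi * \<i> * ?g t = (\<Sum>\<gamma>\<leftarrow>C. contour_integral \<gamma> (\<lambda>z. f z * ?G t z))"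
      using P.crd_dunford[OF b, of C Y]
      unfolding P.dunford_eq_calc[OF enc] P.functional_calculus_eq_calc by simp
    have "(\<lambda>z. ?G t z) holomorphic_on - P.spec"
      using P.vholo_resolvent_vector b by (simp add: vholo_def)
    moreover have "S \<subseteq> - P.spec" using off t S by blast
    ultimately show "continuous_on S (\<lambda>z. f z * ?G t z)"
      using holomorphic_on_imp_continuous_on continuous_on_subset \<open>continuous_on S f\<close>
      by (intro continuous_on_mult) blast+
  qed
  have D0: "?D 0 = D" by (rule ext) simp
  have enc: "encircles U spec C"
    unfolding C_def using \<epsilon>(1) by (intro circles_encircle[OF ps \<epsilon>]) auto
  have H: "2 * of_real pi * \<i> * crd (vL (\<lambda>z. res z (A (res z Y)))) b = (\<Sum>\<gamma>\<leftarrow>C. contour_integral \<gamma> (\<lambda>z. f z * ?H z))"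
    using contour_integral_L[OF enc, of ?H] vh b by (simp add: crd_vL[OF b] vholo_def)
  have Hcont: "continuous_on S (\<lambda>z. f z * ?H z)"
  proof -
    have "S \<subseteq> - spec" using S \<epsilon>(1) by force
    moreover have "?H holomorphic_on - spec" using vh b by (simp add: vholo_def)
    ultimately show ?thesis
      using holomorphic_on_imp_continuous_on continuous_on_subset \<open>continuous_on S f\<close>
      by (intro continuous_on_mult) blast+
  qed
  have sub: "sphere p \<epsilon> \<subseteq> S" if "p \<in> spec" for p using that by (auto simp: S_def)
  have bound: "norm (contour_integral \<gamma> (\<lambda>z. f z * ?G t z) - contour_integral \<gamma> (\<lambda>z. f z * ?G 0 z)
      - t * contour_integral \<gamma> (\<lambda>z. f z * ?H z)) \<le> m * (c * norm t ^ 2 * nrm Y) * (2 * pi * \<epsilon>)"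
    if t: "norm t < \<delta>" and \<gamma>: "\<gamma> \<in> set C" for t \<gamma>
  proof -
    obtain p where p: "p \<in> spec" "\<gamma> = circlepath p \<epsilon>" using \<gamma> ps by (auto simp: C_def)
    have int: "h contour_integrable_on \<gamma>" if "continuous_on S h" for h
      unfolding p using continuous_on_subset[OF that sub[OF p(1)]] \<epsilon>(1)
      by (intro contour_integrable_continuous_circlepath) simp
    note i = has_contour_integral_integral[OF int[OF Gcont[OF t]]]
      has_contour_integral_integral[OF int[OF Gcont[of 0]]]
      has_contour_integral_integral[OF int[OF Hcont]]
    have "((\<lambda>z. f z * ?G t z - f z * ?G 0 z - t * (f z * ?H z)) has_contour_integral
      (contour_integral \<gamma> (\<lambda>z. f z * ?G t z) - contour_integral \<gamma> (\<lambda>z. f z * ?G 0 z)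
      - t * contour_integral \<gamma> (\<lambda>z. f z * ?H z))) (circlepath p \<epsilon>)"
      unfolding p(2)[symmetric] using \<delta> by (intro has_contour_integral_diff has_contour_integral_lmul i) simp
    then show ?thesis
    proof (rule has_contour_integral_bound_circlepath)
      fix z assume "norm (z - p) = \<epsilon>"
      then have z: "z \<in> S" using p by (auto simp: S_def dist_norm norm_minus_commute)
      have eq: "f z * ?G t z - f z * ?G 0 z - t * (f z * ?H z)
        = f z * crd (resolvent smul (?D t) z Y - res z Y - t *\<^sub>C res z (A (res z Y))) b"
        by (simp only: crd.diff crd.scale right_diff_distrib mult.left_commute[of t] D0)
      have r: "nrm (resolvent smul (?D t) z Y - res z Y - t *\<^sub>C res z (A (res z Y))) \<le> c * norm t ^ 2 * nrm Y"
        using rem t S[OF z] by blast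
      have "norm (f z * crd (resolvent smul (?D t) z Y - res z Y - t *\<^sub>C res z (A (res z Y))) b) \<le> m * (c * norm t ^ 2 * nrm Y)"
        unfolding norm_mult using m c z
        by (intro mult_mono order_trans[OF crd_le_nrm[OF b] r]) auto
      then show "norm (f z * ?G t z - f z * ?G 0 z - t * (f z * ?H z)) \<le> m * (c * norm t ^ 2 * nrm Y)"
        unfolding eq .
    qed (use m c \<epsilon> nrm_nonneg in auto)
  qed
  define k where "k = length C * (m * (c * nrm Y) * (2 * pi * \<epsilon>)) / (2 * pi)"
  have "norm (?g t - ?g 0 - t * crd (vL (\<lambda>z. res z (A (res z Y)))) b) \<le> k * norm t ^ 2"
    if t: "norm t < \<delta>" for t
  proof -
    let ?d = "\<lambda>\<gamma>. contour_integral \<gamma> (\<lambda>z. f z * ?G t z) - contour_integral \<gamma> (\<lambda>z. f z * ?G 0 z)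
      - t * contour_integral \<gamma> (\<lambda>z. f z * ?H z)"
    have "2 * of_real pi * \<i> * (?g t - ?g 0 - t * crd (vL (\<lambda>z. res z (A (res z Y)))) b)
      = 2 * of_real pi * \<i> * ?g t - 2 * of_real pi * \<i> * ?g 0
        - t * (2 * of_real pi * \<i> * crd (vL (\<lambda>z. res z (A (res z Y)))) b)"
      by (simp only: right_diff_distrib mult_ac)
    also have "\<dots> = (\<Sum>\<gamma>\<leftarrow>C. ?d \<gamma>)"
      using \<delta> unfolding g[OF t] H g[of 0, simplified norm_zero, OF \<delta>]
      by (simp only: sum_list_subtractf sum_list_const_mult)
    finally have "2 * pi * norm (?g t - ?g 0 - t * crd (vL (\<lambda>z. res z (A (res z Y)))) b) = norm (\<Sum>\<gamma>\<leftarrow>C. ?d \<gamma>)"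
      by (metis (no_types, lifting) norm_mult norm_ii norm_numeral norm_of_real abs_of_pos pi_gt_zero mult.right_neutral)
    also have "\<dots> \<le> (\<Sum>\<gamma>\<leftarrow>C. norm (?d \<gamma>))"
      by (rule norm_sum_list_le)
    also have "\<dots> \<le> (\<Sum>\<gamma>\<leftarrow>C. m * (c * norm t ^ 2 * nrm Y) * (2 * pi * \<epsilon>))"
      by (rule sum_list_mono) (rule bound[OF t])
    also have "\<dots> = length C * (m * (c * norm t ^ 2 * nrm Y) * (2 * pi * \<epsilon>))"
      by (simp add: sum_list_triv)
    finally show ?thesis by (simp add: k_def field_simps)
  qed
  then show ?thesis by (rule has_field_derivative_quadratic_bound[OF \<delta>])
qed

end

section \<open>The scalar identity in formal power series\<close>

text \<open>With \<open>F\<close> as in the introduction, \<open>P = 2 a F(a)\<close>, \<open>Q = 2 b F(b)\<close> and \<open>S = 2 (a + b) F(a + b)\<close>, while \<open>p\<close> and \<open>q\<close> play the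
  role of the exponentials of \<open>a\<close> and \<open>b\<close>.  After multiplication by \<open>a b (a + b)\<close> the divided differences disappear, and
  after multiplication by \<open>(p - 1) (q - 1) (p q - 1)\<close> so do the hyperbolic cotangents; a polynomial identity in
  \<open>a, b, p, q\<close> remains.  The overall factor 4 clears the constant 1/4.\<close>

lemma coth_addition_cancelled:
  fixes a b p q fa fb fc g1 g2 g3 :: "'a::idom"
  assumes ha: "2 * (a * fa + 1) * (p - 1) = a * (p + 1)"
    and hb: "2 * (b * fb + 1) * (q - 1) = b * (q + 1)"
    and hc: "2 * ((a + b) * fc + 1) * (p * q - 1) = (a + b) * (p * q + 1)"
    and g: "g1 * b = fc - fa" "g2 * a = fc - fb" "g3 * (a + b) = fa + fb"
    and nz: "a \<noteq> 0" "b \<noteq> 0" "a + b \<noteq> 0" "p \<noteq> 1" "q \<noteq> 1" "p * q \<noteq> 1"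
  shows "1 + 4 * (fa * fb - fc * (fa + fb) - g3 - g1 - g2) = 0"
proof -
  define P Q S where "P = 2 * (a * fa + 1)" and "Q = 2 * (b * fb + 1)" and "S = 2 * ((a + b) * fc + 1)"
  let ?Z = "1 + 4 * (fa * fb - fc * (fa + fb) - g3 - g1 - g2)"
  let ?T = "(a + b) * P * Q + a * b * (a + b) - S * (b * P + a * Q)"
  have "?Z * (a * b * (a + b)) = a * b * (a + b) * (1 + 4 * (fa * fb - fc * (fa + fb)))
      - 4 * (a * b * (g3 * (a + b)) + a * (a + b) * (g1 * b) + b * (a + b) * (g2 * a))"
    by algebra
  also have "\<dots> = ?T" unfolding g P_def Q_def S_def by algebra
  finally have ZT: "?Z * (a * b * (a + b)) = ?T" .
  have "?T * ((p - 1) * (q - 1) * (p * q - 1)) = (a + b) * (P * (p - 1)) * (Q * (q - 1)) * (p * q - 1)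
      + a * b * (a + b) * ((p - 1) * (q - 1) * (p * q - 1))
      - (S * (p * q - 1)) * (b * (P * (p - 1)) * (q - 1) + a * (Q * (q - 1)) * (p - 1))"
    by algebra
  also have "\<dots> = 0"
    unfolding ha[folded P_def] hb[folded Q_def] hc[folded S_def] by algebra
  finally have "?T = 0" using nz by simp
  with ZT show ?thesis using nz by simp
qed

text \<open>The series \<open>g(w s)\<close> in the outer variable \<open>s\<close>, where \<open>w\<close> is a series in the inner variable \<open>t\<close>.  The two nilpotent
  operators \<open>x\<close> and \<open>y\<close> are represented by \<open>s\<close> and \<open>t s\<close>.  Then \<open>x\<close>, \<open>y\<close> and \<open>x + y\<close> are the cases \<open>w = 1\<close>, \<open>w = t\<close> and
  \<open>w = 1 + t\<close> of one substitution that acts on each coefficient separately, which makes it plain that it is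
  a ring homomorphism.\<close>

definition subst_fps :: "complex fps \<Rightarrow> complex fps \<Rightarrow> complex fps fps"
  where "subst_fps w g = Abs_fps (\<lambda>n. fps_const (g $ n) * w ^ n)"

lemma subst_fps_nth [simp]: "subst_fps w g $ n = fps_const (g $ n) * w ^ n"
  by (simp add: subst_fps_def)

lemma subst_fps_add: "subst_fps w (g + h) = subst_fps w g + subst_fps w h"
  by (rule fps_ext) (simp add: algebra_simps flip: fps_const_add)

lemma subst_fps_diff: "subst_fps w (g - h) = subst_fps w g - subst_fps w h"
  by (rule fps_ext) (simp add: algebra_simps flip: fps_const_sub)

lemma subst_fps_minus: "subst_fps w (- h) = - subst_fps w h"
  by (rule fps_ext) (simp flip: fps_const_neg)

lemma subst_fps_const: "subst_fps w (fps_const c) = fps_const (fps_const c)"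
  by (rule fps_ext) simp

lemma subst_fps_one: "subst_fps w 1 = 1"
  using subst_fps_const[of w 1] by simp

lemma subst_fps_X: "subst_fps w fps_X = fps_const w * fps_X"
proof (rule fps_ext)
  fix n show "subst_fps w fps_X $ n = (fps_const w * fps_X) $ n"
    by (cases "n = 1") (auto simp: fps_X_def)
qed

lemma fps_const_sum: "fps_const (sum f A) = (\<Sum>x\<in>A. fps_const (f x))"
  by (induction A rule: infinite_finite_induct) (simp_all flip: fps_const_add)

lemma subst_fps_mult: "subst_fps w (g * h) = subst_fps w g * subst_fps w h"
proof (rule fps_ext)
  fix n
  have "fps_const (\<Sum>i=0..n. g $ i * h $ (n - i)) * w ^ n
      = (\<Sum>i=0..n. (fps_const (g $ i) * w ^ i) * (fps_const (h $ (n - i)) * w ^ (n - i)))"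
    unfolding fps_const_sum sum_distrib_right
    by (intro sum.cong refl) (simp add: algebra_simps flip: power_add fps_const_mult)
  then show "subst_fps w (g * h) $ n = (subst_fps w g * subst_fps w h) $ n"
    by (simp add: fps_mult_nth)
qed

text \<open>The functional equation of the exponential series, that is, the binomial theorem.\<close>

lemma subst_fps_exp:
  "subst_fps (v + w) (fps_exp 1) = subst_fps v (fps_exp 1) * subst_fps w (fps_exp 1)"
proof (rule fps_ext)
  fix n
  have "fps_const (1 / fact n) * (of_nat (n choose i) * v ^ i * w ^ (n - i))
      = (fps_const (1 / fact i) * v ^ i) * (fps_const (1 / fact (n - i)) * w ^ (n - i))"
    if "i \<le> n" for i
  proof -
    have "1 / fact n * of_nat (n choose i) = (1 / fact i) * (1 / fact (n - i) :: complex)"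
      using binomial_fact[OF that, where 'a=complex] by (simp add: field_simps)
    then have "fps_const (1 / fact n) * (of_nat (n choose i) :: complex fps)
        = fps_const (1 / fact i) * fps_const (1 / fact (n - i))"
      by (simp only: fps_of_nat[symmetric] fps_const_mult)
    then show ?thesis by (metis (no_types, lifting) mult.assoc mult.left_commute)
  qed
  then have "fps_const (1 / fact n) * (v + w) ^ n
      = (\<Sum>i\<le>n. (fps_const (1 / fact i) * v ^ i) * (fps_const (1 / fact (n - i)) * w ^ (n - i)))"
    unfolding binomial_ring sum_distrib_left by (intro sum.cong) auto
  then show "subst_fps (v + w) (fps_exp 1) $ n
      = (subst_fps v (fps_exp 1) * subst_fps w (fps_exp 1)) $ n"
    by (simp add: fps_mult_nth atLeast0AtMost)
qed

lemma fps_expansion_coth_fun: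
  assumes "l \<notin> coth_poles"
  defines "g \<equiv> fps_expansion coth_fun l" and "e \<equiv> fps_const (exp l) * fps_exp 1"
    and "x \<equiv> fps_const l + fps_X"
  shows "2 * (x * g + 1) * (e - 1) = x * (e + 1)"
proof -
  have op: "open (- coth_poles)" using closed_coth_poles by blast
  have "coth_fun analytic_on {l}"
    using holomorphic_coth_fun op assms(1) by (auto simp: analytic_at)
  then have [fps_expansion_intros]: "(\<lambda>z. coth_fun (l + z)) has_fps_expansion g"
    unfolding g_def by (rule analytic_at_imp_has_fps_expansion)
  have "(\<lambda>z. exp l * exp (1 * z)) has_fps_expansion e" unfolding e_def
    by (intro fps_expansion_intros)
  then have [fps_expansion_intros]: "(\<lambda>z. exp (l + z)) has_fps_expansion e" by (simp add: exp_add)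
  have [fps_expansion_intros]: "(\<lambda>z. l + z) has_fps_expansion x" unfolding x_def
    by (intro fps_expansion_intros)
  have lhs: "(\<lambda>z. 2 * ((l + z) * coth_fun (l + z) + 1) * (exp (l + z) - 1)) has_fps_expansion 2 * (x * g + 1) * (e - 1)"
    by (intro fps_expansion_intros)
  have rhs: "(\<lambda>z. (l + z) * (exp (l + z) + 1)) has_fps_expansion x * (e + 1)"
    by (intro fps_expansion_intros)
  have "((\<lambda>z. l + z) \<longlongrightarrow> l + 0) (nhds 0)"
    by (intro tendsto_add tendsto_const filterlim_ident)
  then have "\<forall>\<^sub>F z in nhds 0. l + z \<in> - coth_poles"
    using op assms(1) by (intro topological_tendstoD) auto
  then have "\<forall>\<^sub>F z in nhds 0. 2 * ((l + z) * coth_fun (l + z) + 1) * (exp (l + z) - 1) = (l + z) * (exp (l + z) + 1)"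
    by eventually_elim (use coth_fun_equation in auto)
  from lhs has_fps_expansion_cong[OF this refl]
  have "(\<lambda>z. (l + z) * (exp (l + z) + 1)) has_fps_expansion 2 * (x * g + 1) * (e - 1)"
    by simp
  with rhs show ?thesis using fps_expansion_unique_complex by blast
qed

lemma fps_expansion_coth_fun_uminus:
  "fps_expansion coth_fun (- l) $ k = - ((-1) ^ k * fps_expansion coth_fun l $ k)"
  if "l \<notin> coth_poles" "- l \<notin> coth_poles"
proof -
  have op: "open (- coth_poles)" using closed_coth_poles by blast
  have "(deriv ^^ k) (\<lambda>w. coth_fun (- 1 * w)) l = (- 1) ^ k * (deriv ^^ k) coth_fun (- 1 * l)"
  proof (rule higher_deriv_compose_linear[OF holomorphic_coth_fun, of "uminus ` (- coth_poles)"])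
    show "open (uminus ` (- coth_poles))" using op by (rule open_negations)
    show "l \<in> uminus ` (- coth_poles)" using that(2) by (intro image_eqI[of _ _ "- l"]) auto
  qed (use op in auto)
  moreover have "(deriv ^^ k) (\<lambda>w. coth_fun (- 1 * w)) l = - (deriv ^^ k) coth_fun l"
    using higher_deriv_uminus[OF holomorphic_coth_fun op, of l k] that by (simp add: coth_fun_minus)
  ultimately have "(- 1) ^ k * (deriv ^^ k) coth_fun (- l) = - (deriv ^^ k) coth_fun l" by simp
  then have "(deriv ^^ k) coth_fun (- l) = - ((- 1) ^ k * (deriv ^^ k) coth_fun l)"
    by (metis (no_types, lifting) left_minus_one_mult_self mult_minus_right)
  then show ?thesis by (simp add: fps_expansion_def)
qed

text \<open>The factors to be cancelled are seen to be nonzero from their coefficients of \<open>s\<close>, which are 1, \<open>t\<close>, \<open>1 + t\<close> and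
  nonzero multiples of these.  Here it matters that \<open>x\<close> and \<open>y\<close> are formal variables: the argument is the same
  whether or not \<open>l\<close>, \<open>m\<close> or \<open>l + m\<close> is 0.\<close>

lemma formal_dybe:
  fixes l m :: complex
  assumes poles: "l \<notin> coth_poles" "m \<notin> coth_poles" "l + m \<notin> coth_poles"
  defines "fa \<equiv> subst_fps 1 (fps_expansion coth_fun l)"
    and "fb \<equiv> subst_fps fps_X (fps_expansion coth_fun m)"
    and "fc \<equiv> subst_fps (1 + fps_X) (fps_expansion coth_fun (l + m))"
    and "a \<equiv> subst_fps 1 (fps_const l + fps_X)"
    and "b \<equiv> subst_fps fps_X (fps_const m + fps_X)"
  assumes g: "g1 * b = fc - fa" "g2 * a = fc - fb" "g3 * (a + b) = fa + fb"
  shows "1 + 4 * (fa * fb - fc * (fa + fb) - g3 - g1 - g2) = 0"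
proof -
  define e where "e = (\<lambda>l::complex. fps_const (exp l) * fps_exp 1 :: complex fps)"
  define p q where "p = subst_fps 1 (e l)" and "q = subst_fps fps_X (e m)"
  have pq: "subst_fps (1 + fps_X) (e (l + m)) = p * q"
    by (simp add: p_def q_def e_def subst_fps_mult subst_fps_const subst_fps_exp exp_add
        flip: fps_const_mult)
  have ab: "subst_fps (1 + fps_X) (fps_const (l + m) + fps_X) = a + b"
    by (simp add: a_def b_def subst_fps_add subst_fps_const subst_fps_X algebra_simps
        flip: fps_const_add)
  have eq: "2 * (subst_fps w (fps_const k + fps_X) * subst_fps w (fps_expansion coth_fun k) + 1) * (subst_fps w (e k) - 1)
      = subst_fps w (fps_const k + fps_X) * (subst_fps w (e k) + 1)" if "k \<notin> coth_poles" for k w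
  proof -
    have "subst_fps w (2 * ((fps_const k + fps_X) * fps_expansion coth_fun k + 1) * (e k - 1))
      = subst_fps w ((fps_const k + fps_X) * (e k + 1))"
      unfolding e_def by (rule arg_cong[OF fps_expansion_coth_fun[OF that]])
    moreover have "subst_fps w 2 = 2" using subst_fps_add[of w 1 1] by (simp add: subst_fps_one)
    ultimately show ?thesis
      by (simp only: subst_fps_mult subst_fps_add[of _ "_ * _"] subst_fps_add[of _ "e _"] subst_fps_diff subst_fps_one)
  qed
  show ?thesis
  proof (rule coth_addition_cancelled[OF _ _ _ g])
    show "2 * (a * fa + 1) * (p - 1) = a * (p + 1)"
      unfolding a_def fa_def p_def by (rule eq[OF poles(1)])
    show "2 * (b * fb + 1) * (q - 1) = b * (q + 1)"
      unfolding b_def fb_def q_def by (rule eq[OF poles(2)])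
    show "2 * ((a + b) * fc + 1) * (p * q - 1) = (a + b) * (p * q + 1)"
      unfolding fc_def ab[symmetric] pq[symmetric] by (rule eq[OF poles(3)])
    have 1: "a $ 1 = 1" "b $ 1 = fps_X" "(a + b) $ 1 = 1 + fps_X" by (simp_all add: a_def b_def)
    have 2: "p $ 1 = fps_const (exp l)" "q $ 1 = fps_const (exp m) * fps_X"
      by (simp_all add: p_def q_def e_def)
    have 3: "(p * q) $ 1 = fps_const (exp (l + m)) * (1 + fps_X)"
      unfolding pq[symmetric] by (simp add: e_def)
    have 4: "(1 + fps_X :: complex fps) $ 0 = 1" by simp
    then have 5: "(1 + fps_X :: complex fps) \<noteq> 0" by (metis fps_zero_nth zero_neq_one)
    show "a \<noteq> 0" "b \<noteq> 0" "a + b \<noteq> 0" using 1 5 by (metis fps_zero_nth fps_X_neq_zero zero_neq_one)+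
    show "p \<noteq> 1" "q \<noteq> 1" using 2 by auto
    \<comment> \<open>compare the coefficients of \<open>s\<close>\<close>
    show "p * q \<noteq> 1"
    proof
      assume "p * q = 1"
      with 3 have "(0 :: complex fps) = fps_const (exp (l + m)) * (1 + fps_X)" by (metis fps_one_nth zero_neq_one)
      with 5 show False by simp
    qed
  qed
qed

section \<open>Evaluating formal series on brackets\<close>

lemma fps_X_binomial_nth_eq_0: "j + k < l \<Longrightarrow> (fps_X ^ j * (1 + fps_X) ^ k :: complex fps) $ l = 0"
proof (induction k arbitrary: l)
  case (Suc k)
  let ?P = "fps_X ^ j * (1 + fps_X) ^ k :: complex fps"
  obtain l' where l': "l = Suc l'" using Suc.prems by (cases l) auto
  have "(fps_X ^ j * (1 + fps_X) ^ Suc k :: complex fps) = ?P + fps_X * ?P"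
    by (simp only: power_Suc distrib_left distrib_right mult_1_left mult_ac)
  then have "(fps_X ^ j * (1 + fps_X) ^ Suc k :: complex fps) $ l = ?P $ l + ?P $ l'"
    unfolding l' by (simp only: fps_add_nth fps_X_mult_nth) simp
  then show ?case using Suc.IH[of l] Suc.IH[of l'] Suc.prems l' by simp
qed simp

lemma sum_triangle_square:
  fixes h :: "nat \<Rightarrow> nat \<Rightarrow> 'a::comm_monoid_add"
  assumes "\<And>i j. n \<le> i + j \<Longrightarrow> h i j = 0"
  shows "(\<Sum>m<n. \<Sum>i\<le>m. h i (m - i)) = (\<Sum>i<n. \<Sum>j<n. h i j)"
proof -
  have "(\<Sum>m<n. \<Sum>i\<le>m. h i (m - i)) = (\<Sum>(i, j)\<in>{(i, j). i + j < n}. h i j)"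
    by (rule sum.triangle_reindex[symmetric])
  also have "\<dots> = (\<Sum>(i, j)\<in>{..<n} \<times> {..<n}. h i j)"
    by (rule sum.mono_neutral_left) (use assms in \<open>auto, meson not_le\<close>)
  finally show ?thesis by (simp add: sum.cartesian_product)
qed

context fd_complex_space
begin

text \<open>\<open>B i j\<close> stands for \<open>[x\<^sup>i X, y\<^sup>j Y]\<close>.  The monomial \<open>s\<^sup>m t\<^sup>l\<close> represents \<open>x\<^sup>m\<^sup>-\<^sup>l y\<^sup>l\<close>, so it is evaluated to
  \<open>B (m - l) l\<close>.\<close>

definition homog :: "(nat \<Rightarrow> nat \<Rightarrow> 'g) \<Rightarrow> nat \<Rightarrow> complex fps \<Rightarrow> 'g"
  where "homog B m \<Psi> = (\<Sum>l\<le>m. (\<Psi> $ l) *\<^sub>C B (m - l) l)"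

text \<open>Only \<open>m < n\<close> is summed; \<open>n\<close> will be so large that \<open>B i j = 0\<close> for \<open>i + j \<ge> n\<close>.\<close>

definition eval2 :: "nat \<Rightarrow> (nat \<Rightarrow> nat \<Rightarrow> 'g) \<Rightarrow> complex fps fps \<Rightarrow> 'g"
  where "eval2 n B \<Phi> = (\<Sum>m<n. homog B m (\<Phi> $ m))"

lemma homog_add: "homog B m (\<Phi> + \<Psi>) = homog B m \<Phi> + homog B m \<Psi>"
  by (simp add: homog_def scale_left_distrib sum.distrib)

lemma homog_scale: "homog B m (fps_const c * \<Phi>) = c *\<^sub>C homog B m \<Phi>"
  by (simp add: homog_def scale_sum_right)

lemma homog_sum: "homog B m (\<Sum>i\<in>I. \<Phi> i) = (\<Sum>i\<in>I. homog B m (\<Phi> i))"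
  by (induction I rule: infinite_finite_induct) (auto simp: homog_add, auto simp: homog_def)

lemma eval2_add: "eval2 n B (\<Phi> + \<Psi>) = eval2 n B \<Phi> + eval2 n B \<Psi>"
  by (simp add: eval2_def homog_add sum.distrib)

lemma eval2_scale: "eval2 n B (fps_const (fps_const c) * \<Phi>) = c *\<^sub>C eval2 n B \<Phi>"
  by (simp add: eval2_def homog_scale scale_sum_right)

lemma eval2_minus: "eval2 n B (- \<Phi>) = - eval2 n B \<Phi>"
  using eval2_scale[of n B "-1" \<Phi>] by (simp flip: fps_const_neg)

lemma eval2_diff: "eval2 n B (\<Phi> - \<Psi>) = eval2 n B \<Phi> - eval2 n B \<Psi>"
  using eval2_add[of n B \<Phi> "- \<Psi>"] by (simp add: eval2_minus)

text \<open>\<open>N\<close> is the nilpotent part of \<open>D\<close> on the value of the bracket; by the derivation property it acts as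
  \<open>x + y = (1 + t) s\<close>.  The degree bound \<open>fps_X_binomial_nth_eq_0\<close> ensures that multiplication by \<open>1 + t\<close> does not lose a term at the
  upper end of the sum.\<close>

lemma homog_binomial:
  assumes N: "Vector_Spaces.linear smul smul N"
    and NB: "\<And>i j. N (B i j) = B (Suc i) j + B i (Suc j)"
  shows "homog B (i + j + k) (fps_X ^ j * (1 + fps_X) ^ k) = (N ^^ k) (B i j)"
proof (induction k)
  case 0
  have "homog B (i + j) (fps_X ^ j) = (\<Sum>l\<le>i + j. if l = j then B (i + j - l) l else 0)"
    unfolding homog_def by (intro sum.cong) auto
  then show ?case by simp
next
  case (Suc k)
  interpret N: Vector_Spaces.linear smul smul N by fact
  let ?P = "fps_X ^ j * (1 + fps_X) ^ k :: complex fps" and ?m = "i + j + k"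
  have "homog B (Suc ?m) (fps_X * ?P) = (\<Sum>l\<le>?m. (?P $ l) *\<^sub>C B (?m - l) (Suc l))"
    unfolding homog_def by (subst sum.atMost_Suc_shift) (simp add: fps_X_mult_nth)
  moreover have "homog B (Suc ?m) ?P = (\<Sum>l\<le>?m. (?P $ l) *\<^sub>C B (Suc (?m - l)) l)"
    unfolding homog_def using fps_X_binomial_nth_eq_0[of j k "Suc ?m"]
    by (auto simp: Suc_diff_le intro!: sum.cong)
  moreover have "(N ^^ Suc k) (B i j) = N (homog B ?m ?P)" by (simp add: Suc.IH)
  ultimately have "(N ^^ Suc k) (B i j) = homog B (Suc ?m) ?P + homog B (Suc ?m) (fps_X * ?P)"
    by (simp add: homog_def N.sum N.scale NB scale_right_distrib sum.distrib)
  also have "\<dots> = homog B (Suc ?m) (fps_X ^ j * (1 + fps_X) ^ Suc k)"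
    by (simp add: algebra_simps flip: homog_add)
  finally show ?case by simp
qed

lemma funpow_double_sequence_eq_0:
  assumes N: "Vector_Spaces.linear smul smul N"
    and NB: "\<And>i j. N (B i j) = B (Suc i) j + B i (Suc j)"
    and B0: "\<And>i j. n \<le> i + j \<Longrightarrow> B i j = 0"
    and le: "n \<le> i + j + k"
  shows "(N ^^ k) (B i j) = 0"
  using le
proof (induction k arbitrary: i j)
  case (Suc k)
  interpret Nk: Vector_Spaces.linear smul smul "N ^^ k" by (rule linear_funpow[OF N])
  have "(N ^^ Suc k) (B i j) = (N ^^ k) (B (Suc i) j) + (N ^^ k) (B i (Suc j))"
    by (simp add: funpow_swap1 NB Nk.add)
  then show ?case using Suc by simp
qed (simp add: B0)

text \<open>The dictionary between operators and formal series: applying \<open>u(x)\<close> to the left entry, \<open>v(y)\<close> to the right entry and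
  \<open>g(N)\<close> to the resulting bracket corresponds to the product \<open>u(x) v(y) g(x + y)\<close>.\<close>

lemma eval2_mult_subst:
  assumes N: "Vector_Spaces.linear smul smul N"
    and NB: "\<And>i j. N (B i j) = B (Suc i) j + B i (Suc j)"
    and B0: "\<And>i j. n \<le> i + j \<Longrightarrow> B i j = 0"
  shows "eval2 n B (subst_fps 1 u * subst_fps fps_X v * subst_fps (1 + fps_X) g)
    = (\<Sum>k<n. (g $ k) *\<^sub>C (N ^^ k) (\<Sum>i<n. \<Sum>j<n. (u $ i * v $ j) *\<^sub>C B i j))"
proof -
  note linNk = linear_funpow[OF N]
  interpret Nk: Vector_Spaces.linear smul smul "N ^^ k" for k by (rule linNk)
  note NkB = funpow_double_sequence_eq_0[where N=N and B=B, OF N NB B0]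
  define H where "H q = (\<Sum>i\<le>q. (u $ i * v $ (q - i)) *\<^sub>C B i (q - i))" for q
  have uv: "(subst_fps 1 u * subst_fps fps_X v) $ q
      = (\<Sum>i\<le>q. fps_const (u $ i) * (fps_const (v $ (q - i)) * fps_X ^ (q - i)))" for q
    by (simp add: fps_mult_nth atLeast0AtMost)
  have monomial: "homog B m (fps_const (g $ (m - q)) * (1 + fps_X) ^ (m - q) * (fps_const (u $ i) * (fps_const (v $ (q - i)) * fps_X ^ (q - i))))
      = (g $ (m - q)) *\<^sub>C (u $ i * v $ (q - i)) *\<^sub>C (N ^^ (m - q)) (B i (q - i))" if "i \<le> q" "q \<le> m" for m q i
  proof -
    have "fps_const (g $ (m - q)) * (1 + fps_X) ^ (m - q) * (fps_const (u $ i) * (fps_const (v $ (q - i)) * fps_X ^ (q - i)))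
      = fps_const (g $ (m - q)) * (fps_const (u $ i * v $ (q - i)) * (fps_X ^ (q - i) * (1 + fps_X) ^ (m - q)))"
      by (simp only: fps_const_mult[symmetric] mult_ac)
    moreover have "homog B m (fps_X ^ (q - i) * (1 + fps_X) ^ (m - q)) = (N ^^ (m - q)) (B i (q - i))"
      using homog_binomial[where N=N and B=B and i=i and j="q - i" and k="m - q", OF N NB] that by simp
    ultimately show ?thesis by (simp only: homog_scale)
  qed
  have "homog B m ((subst_fps 1 u * subst_fps fps_X v * subst_fps (1 + fps_X) g) $ m)
      = (\<Sum>q\<le>m. (g $ (m - q)) *\<^sub>C (N ^^ (m - q)) (H q))" for m
  proof -
    have "(subst_fps 1 u * subst_fps fps_X v * subst_fps (1 + fps_X) g) $ m
      = (\<Sum>q\<le>m. \<Sum>i\<le>q. fps_const (g $ (m - q)) * (1 + fps_X) ^ (m - q) * (fps_const (u $ i) * (fps_const (v $ (q - i)) * fps_X ^ (q - i))))"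
      unfolding fps_mult_nth[of "_ * _"] atLeast0AtMost uv subst_fps_nth sum_distrib_right
      by (intro sum.cong refl mult.commute)
    then show ?thesis
      by (simp only: homog_sum H_def Nk.sum Nk.scale scale_sum_right) (intro sum.cong refl monomial; simp)
  qed
  then have "eval2 n B (subst_fps 1 u * subst_fps fps_X v * subst_fps (1 + fps_X) g)
      = (\<Sum>m<n. \<Sum>q\<le>m. (g $ (m - q)) *\<^sub>C (N ^^ (m - q)) (H q))"
    by (simp add: eval2_def)
  also have "\<dots> = (\<Sum>q<n. \<Sum>k<n. (g $ k) *\<^sub>C (N ^^ k) (H q))"
    by (rule sum_triangle_square) (auto simp: H_def Nk.sum Nk.scale NkB intro!: sum.neutral)
  also have "\<dots> = (\<Sum>k<n. (g $ k) *\<^sub>C (N ^^ k) (\<Sum>q<n. H q))"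
    by (subst sum.swap) (simp add: Nk.sum scale_sum_right)
  also have "(\<Sum>q<n. H q) = (\<Sum>i<n. \<Sum>j<n. (u $ i * v $ j) *\<^sub>C B i j)"
    unfolding H_def by (rule sum_triangle_square) (simp add: B0)
  finally show ?thesis .
qed

end

text \<open>The series \<open>1 / (w - x)\<close>, which expresses the resolvent on a generalised eigenvector.\<close>

definition geometric_fps :: "complex \<Rightarrow> complex fps"
  where "geometric_fps w = Abs_fps (\<lambda>k. inverse w ^ Suc k)"

lemma geometric_fps_inverse: "w \<noteq> 0 \<Longrightarrow> geometric_fps w * (fps_const w - fps_X) = 1"
proof (rule fps_ext)
  fix n assume "w \<noteq> 0"
  then show "(geometric_fps w * (fps_const w - fps_X)) $ n = 1 $ n"
    by (cases n) (auto simp: geometric_fps_def right_diff_distrib fps_X_mult_right_nth)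
qed

text \<open>The series \<open>1 / (w + x)\<close>, which expresses the transposed resolvent.\<close>

definition alternating_fps :: "complex \<Rightarrow> complex fps"
  where "alternating_fps w = Abs_fps (\<lambda>k. (- 1) ^ k * inverse w ^ Suc k)"

lemma alternating_fps_inverse: "w \<noteq> 0 \<Longrightarrow> alternating_fps w * (fps_const w + fps_X) = 1"
proof (rule fps_ext)
  fix n assume "w \<noteq> 0"
  then show "(alternating_fps w * (fps_const w + fps_X)) $ n = 1 $ n"
    by (cases n) (auto simp: alternating_fps_def distrib_left fps_X_mult_right_nth)
qed

lemma fps_fps_ext:
  fixes \<Phi> \<Psi> :: "complex fps fps"
  assumes "\<And>m l. (\<Phi> $ m) $ l = (\<Psi> $ m) $ l" shows "\<Phi> = \<Psi>"
  by (intro fps_ext assms)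

lemma fps_fps_mult_nth:
  fixes \<Phi> \<Psi> :: "complex fps fps"
  shows "((\<Phi> * \<Psi>) $ m) $ l = (\<Sum>i=0..m. \<Sum>j=0..l. (\<Phi> $ i) $ j * (\<Psi> $ (m - i)) $ (l - j))"
  by (simp add: fps_mult_nth fps_sum_nth)

context residue_functional
begin

definition fholo :: "(complex \<Rightarrow> complex fps fps) \<Rightarrow> bool"
  where "fholo \<Psi> \<longleftrightarrow> (\<forall>m l. (\<lambda>z. (\<Psi> z $ m) $ l) holomorphic_on - K)"

definition fL :: "(complex \<Rightarrow> complex fps fps) \<Rightarrow> complex fps fps"
  where "fL \<Psi> = Abs_fps (\<lambda>m. Abs_fps (\<lambda>l. L (\<lambda>z. (\<Psi> z $ m) $ l)))"

lemma fL_nth [simp]: "(fL \<Psi> $ m) $ l = L (\<lambda>z. (\<Psi> z $ m) $ l)"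
  by (simp add: fL_def)

lemma fholo_mult: "fholo \<Phi> \<Longrightarrow> fholo \<Psi> \<Longrightarrow> fholo (\<lambda>z. \<Phi> z * \<Psi> z)"
  unfolding fholo_def fps_fps_mult_nth by (auto intro!: holomorphic_intros)

lemma fholo_subst:
  fixes u :: "complex \<Rightarrow> complex fps"
  assumes "\<And>k. (\<lambda>z. u z $ k) holomorphic_on - K"
  shows "fholo (\<lambda>z. subst_fps w (u z))"
  unfolding fholo_def by (auto intro!: holomorphic_intros assms)

text \<open>Each coefficient of the product is a finite sum.  The divided differences are characterised with this rule: the
  divisor is moved under the integral and cancelled there by a resolvent identity.\<close>

lemma fL_mult_const: "fholo \<Psi> \<Longrightarrow> fL (\<lambda>z. \<Psi> z * \<Phi>) = fL \<Psi> * \<Phi>"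
  by (rule fps_fps_ext)
     (simp add: fps_fps_mult_nth fholo_def L_sum L_cmult[of _ "_"] mult.commute[of _ "(\<Phi> $ _) $ _"]
        holomorphic_on_sum holomorphic_on_mult)

lemma fL_diff: "fholo \<Phi> \<Longrightarrow> fholo \<Psi> \<Longrightarrow> fL (\<lambda>z. \<Phi> z - \<Psi> z) = fL \<Phi> - fL \<Psi>"
  by (rule fps_fps_ext) (simp add: fholo_def L_diff)

lemma fL_cong: "(\<And>z. z \<notin> K \<Longrightarrow> \<Phi> z = \<Psi> z) \<Longrightarrow> fL \<Phi> = fL \<Psi>"
  by (rule fps_fps_ext) (auto intro: L_cong)

lemma fL_subst:
  fixes u :: "complex \<Rightarrow> complex fps"
  assumes "\<And>k. (\<lambda>z. u z $ k) holomorphic_on - K"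
  shows "fL (\<lambda>z. subst_fps w (u z)) = subst_fps w (Abs_fps (\<lambda>k. L (\<lambda>z. u z $ k)))"
  by (intro fps_fps_ext) (simp add: mult.commute[of _ "(w ^ _) $ _"] L_cmult[OF assms])

lemma geometric_fps_holomorphic: "p \<in> K \<Longrightarrow> (\<lambda>z. geometric_fps (z - p) $ k) holomorphic_on - K"
  unfolding geometric_fps_def by (auto intro!: holomorphic_pole_power simp del: power_Suc)

lemma alternating_fps_holomorphic: "p \<in> K \<Longrightarrow> (\<lambda>z. alternating_fps (z - p) $ k) holomorphic_on - K"
  unfolding alternating_fps_def by (auto intro!: holomorphic_intros holomorphic_pole_power simp del: power_Suc)

lemma fL_geometric: "p \<in> K \<Longrightarrow> fL (\<lambda>z. subst_fps w (geometric_fps (z - p))) = subst_fps w (fps_expansion f p)"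
  by (subst fL_subst[OF geometric_fps_holomorphic])
     (simp_all add: geometric_fps_def L_power fps_nth_inverse flip: power_Suc)

lemma fL_alternating:
  "p \<in> K \<Longrightarrow> fL (\<lambda>z. subst_fps w (alternating_fps (z - p)))
    = subst_fps w (Abs_fps (\<lambda>k. (-1) ^ k * fps_expansion f p $ k))"
  by (subst fL_subst[OF alternating_fps_holomorphic])
     (simp_all add: alternating_fps_def L_power L_cmult holomorphic_pole_power flip: power_Suc)

end

context fd_calculus
begin

lemma vholo_eval2: "fholo \<Psi> \<Longrightarrow> vholo (- spec) (\<lambda>z. eval2 n B (\<Psi> z))"
  unfolding eval2_def homog_def fholo_def by (intro vholo_sum vholo_scale vholo_const) auto

lemma vL_eval2:
  assumes "fholo \<Psi>"
  shows "vL (\<lambda>z. eval2 n B (\<Psi> z)) = eval2 n B (fL \<Psi>)"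
proof (rule crd_eqI)
  fix b assume b: "b \<in> E"
  have h: "(\<lambda>z. (\<Psi> z $ m) $ l) holomorphic_on - spec" for m l using assms by (simp add: fholo_def)
  have "crd (vL (\<lambda>z. eval2 n B (\<Psi> z))) b
      = L (\<lambda>z. \<Sum>m<n. \<Sum>l\<le>m. crd (B (m - l) l) b * (\<Psi> z $ m) $ l)"
    by (simp add: crd_vL[OF b] eval2_def homog_def crd.sum crd.scale mult.commute)
  also have "\<dots> = (\<Sum>m<n. \<Sum>l\<le>m. crd (B (m - l) l) b * L (\<lambda>z. (\<Psi> z $ m) $ l))"
    by (simp only: L_sum L_cmult h holomorphic_on_sum holomorphic_on_mult holomorphic_on_const)
  also have "\<dots> = crd (eval2 n B (fL \<Psi>)) b"
    by (simp add: eval2_def homog_def crd.sum crd.scale mult.commute)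
  finally show "crd (vL (\<lambda>z. eval2 n B (\<Psi> z))) b = \<dots>" .
qed

end

context fd_operator
begin

definition series :: "nat \<Rightarrow> complex \<Rightarrow> complex fps \<Rightarrow> 'g \<Rightarrow> 'g"
  where "series n l u X = (\<Sum>k<n. (u $ k) *\<^sub>C (shift l ^^ k) X)"

lemma neumann_eq_series: "neumann l n z X = series n l (geometric_fps (z - l)) X"
  by (simp add: neumann_def series_def geometric_fps_def)

lemma series_one: "(shift l ^^ n) X = 0 \<Longrightarrow> series n l 1 X = X"
proof (cases n)
  case (Suc k)
  have "series n l 1 X = (\<Sum>i<n. if i = 0 then X else 0)"
    unfolding series_def by (intro sum.cong) auto
  then show ?thesis using Suc by simp
qed (simp add: series_def)

end

lemma (in fd_calculus) calc_eq_series: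
  "l \<in> spec \<Longrightarrow> (shift l ^^ n) X = 0 \<Longrightarrow> calc X = series n l (fps_expansion f l) X"
  by (simp add: calc_gen_eig series_def)

section \<open>The r-matrix: derivative, antisymmetry, equivariance\<close>

context metric_lie_algebra
begin

sublocale fd_complex_space smul E
  by unfold_locales

sublocale bl: Vector_Spaces.linear smul smul "\<lambda>X. bracket X Y" for Y by (rule bracket_linear_left)
sublocale br: Vector_Spaces.linear smul smul "\<lambda>Y. bracket X Y" for X by (rule bracket_linear_right)
sublocale fl: Vector_Spaces.linear smul "(*)" "\<lambda>X. form X Y" for Y by (rule form_linear_left)
sublocale fr: Vector_Spaces.linear smul "(*)" "\<lambda>Y. form X Y" for X by (rule form_linear_right)

lemma bracket_antisym: "bracket X Y = - bracket Y X"
proof -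
  have "bracket (X + Y) (X + Y) = bracket X X + bracket Y X + (bracket X Y + bracket Y Y)"
    by (simp only: bl.add br.add)
  then have "bracket X Y + bracket Y X = 0" by (simp add: bracket_self add.commute)
  then show ?thesis by (rule add_eq_0_iff2[THEN iffD1])
qed

lemma bracket_derivation: "bracket W (bracket X Y) = bracket (bracket W X) Y + bracket X (bracket W Y)"
proof -
  let ?P = "bracket W (bracket X Y)" and ?Q = "bracket (bracket W X) Y" and ?S = "bracket X (bracket W Y)"
  have "bracket X (bracket Y W) = - ?S" by (subst bracket_antisym[of Y W]) (simp add: br.neg)
  moreover have "bracket Y (bracket W X) = - ?Q" by (rule bracket_antisym)
  ultimately have "?P + - ?S + - ?Q = 0" using jacobi[of W X Y] by simp
  moreover have "?P = (?P + - ?S + - ?Q) + (?Q + ?S)" by simp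
  ultimately show ?thesis by simp
qed

text \<open>The gradient term pairs a linear functional of the direction with dual bases; if the functional is \<open>\<langle>Z, _\<rangle>\<close>, the sum is
  just \<open>Z\<close>, whichever dual bases are used.\<close>

lemma dual_bases_expand:
  assumes "dual_bases smul form J T T'"
  shows "(\<Sum>j\<in>J. smul (form Z (T j)) (T' j)) = Z"
proof -
  have J: "finite J" "inj_on T' J" "span (T' ` J) = UNIV"
    and d: "\<And>j k. j \<in> J \<Longrightarrow> k \<in> J \<Longrightarrow> form (T j) (T' k) = (if j = k then 1 else 0)"
    using assms by (auto simp: dual_bases_def basis_family_def)
  have "Z \<in> span (T' ` J)" using J by simp
  then obtain u where "Z = (\<Sum>v\<in>T' ` J. smul (u v) v)"
    using J(1) by (auto simp: span_finite)
  then have Z: "Z = (\<Sum>j\<in>J. smul (u (T' j)) (T' j))" by (simp add: sum.reindex[OF J(2)])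
  have "form Z (T i) = u (T' i)" if i: "i \<in> J" for i
  proof -
    have "form Z (T i) = (\<Sum>j\<in>J. u (T' j) * form (T' j) (T i))"
      by (subst Z) (simp only: fl.sum fl.scale)
    also have "\<dots> = (\<Sum>j\<in>J. if i = j then u (T' j) else 0)"
      using d i by (intro sum.cong) (auto simp: form_sym[of "T' _"])
    finally show ?thesis using J(1) i by simp
  qed
  then show ?thesis by (subst (2) Z) simp
qed

end

locale regular_point = metric_lie_algebra smul E bracket form
  for smul :: "complex \<Rightarrow> 'g \<Rightarrow> 'g::ab_group_add" (infixr "*\<^sub>C" 75) and E bracket form +
  fixes \<omega> :: 'g
  assumes regular: "\<omega> \<in> regular_set smul bracket"
begin

sublocale ad: fd_operator smul E "bracket \<omega>"
  by unfold_locales (auto simp: br.add br.scale)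

sublocale ad: fd_calculus smul E "bracket \<omega>" coth_fun "- coth_poles"
proof unfold_locales
  show "open (- coth_poles)" using closed_coth_poles by blast
  show "finite (op_spectrum smul (bracket \<omega>))" by (rule ad.finite_spec)
  show "op_spectrum smul (bracket \<omega>) \<subseteq> - coth_poles" using regular by (auto simp: regular_set_def)
  show "coth_fun holomorphic_on - coth_poles" by (rule holomorphic_coth_fun)
  show "finite (cball 0 r - - coth_poles)" for r using coth_poles_locally_finite by (simp add: Diff_Compl)
qed

abbreviation "R \<equiv> ad.calc"
abbreviation "res \<equiv> ad.res"

sublocale R: Vector_Spaces.linear smul smul R
  by (rule ad.linear_calc)

lemma r_matrix_eq: "r_matrix smul E bracket \<omega> = R"
  unfolding r_matrix_def by (rule ad.functional_calculus_eq_calc)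

lemma well_defined: "r_matrix_well_defined smul E bracket \<omega>"
  unfolding r_matrix_well_defined_def r_matrix_eq
  using ad.exists_encircling ad.dunford_eq_calc ad.linear_calc by auto

text \<open>The directional derivative of \<open>R\<close> at \<open>\<omega>\<close>, in the form that differentiation under the integral produces.\<close>

definition dR :: "'g \<Rightarrow> 'g \<Rightarrow> 'g"
  where "dR S X = ad.vL (\<lambda>z. res z (bracket S (res z X)))"

lemma vholo_dR: "vholo (- ad.spec) (\<lambda>z. res z (bracket S (res z X)))"
  by (intro ad.vholo_resolvent vholo_operator[OF bracket_linear_right] ad.vholo_resolvent_vector)

lemma linear_dR: "Vector_Spaces.linear smul smul (dR S)"
proof unfold_locales
  show "dR S (X + Y) = dR S X + dR S Y" for X Y
    unfolding dR_def ad.vL_add[OF vholo_dR vholo_dR, symmetric]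
    by (rule ad.vL_cong) (simp add: ad.resolvent_add br.add)
  show "dR S (c *\<^sub>C X) = c *\<^sub>C dR S X" for c X
    unfolding dR_def ad.vL_scale[OF vholo_dR, symmetric]
    by (rule ad.vL_cong) (simp add: ad.resolvent_scale br.scale)
qed

sublocale dR: Vector_Spaces.linear smul smul "dR S" for S
  by (rule linear_dR)

lemma linear_dR_direction: "Vector_Spaces.linear smul smul (\<lambda>S. dR S X)"
proof unfold_locales
  show "dR (S + S') X = dR S X + dR S' X" for S S'
    unfolding dR_def ad.vL_add[OF vholo_dR vholo_dR, symmetric]
    by (rule ad.vL_cong) (simp add: ad.resolvent_add bl.add)
  show "dR (c *\<^sub>C S) X = c *\<^sub>C dR S X" for c S
    unfolding dR_def ad.vL_scale[OF vholo_dR, symmetric]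
    by (rule ad.vL_cong) (simp add: ad.resolvent_scale bl.scale)
qed

sublocale dR_direction: Vector_Spaces.linear smul smul "\<lambda>S. dR S X" for X
  by (rule linear_dR_direction)

lemma has_dir_deriv_dR: "has_dir_deriv smul E (r_matrix smul E bracket) S \<omega> (dR S)"
  unfolding has_dir_deriv_def
proof (intro conjI allI ballI)
  fix Y b assume b: "b \<in> E"
  have "bracket (\<omega> + t *\<^sub>C S) = (\<lambda>X. bracket \<omega> X + t *\<^sub>C bracket S X)" for t
    by (rule ext) (simp add: bl.add bl.scale)
  then show "((\<lambda>t. crd (r_matrix smul E bracket (\<omega> + t *\<^sub>C S) Y) b) has_field_derivative crd (dR S Y) b) (at 0)"
    using ad.has_field_derivative_calculus[OF bracket_linear_right[of S] b, of Y]
    by (simp add: r_matrix_def dR_def)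
qed (rule linear_dR)

lemma dir_deriv_eq: "dir_deriv smul E (r_matrix smul E bracket) S \<omega> = dR S"
  unfolding dir_deriv_def
proof (rule the_equality)
  fix D assume D: "has_dir_deriv smul E (r_matrix smul E bracket) S \<omega> D"
  show "D = dR S"
  proof (rule ext, rule crd_eqI)
    fix Y b assume "b \<in> E"
    then show "crd (D Y) b = crd (dR S Y) b"
      using D has_dir_deriv_dR[of S] unfolding has_dir_deriv_def by (blast intro: DERIV_unique)
  qed
qed (rule has_dir_deriv_dR)

text \<open>If \<open>- l\<close> were regular, then \<open>- (D + l)\<close> would be surjective, and an eigenvector for \<open>l\<close> would be orthogonal to its range.\<close>

lemma spec_uminus:
  assumes "l \<in> ad.spec" shows "- l \<in> ad.spec"
proof (rule ccontr)
  assume n: "- l \<notin> ad.spec"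
  obtain X where X: "ad.shift l X = 0" "X \<noteq> 0" using ad.spec_eigenvector[OF assms] .
  have "form X Y = 0" for Y
  proof -
    let ?W = "res (- l) Y"
    have "form X Y = form X ((- l) *\<^sub>C ?W - bracket \<omega> ?W)" by (simp only: ad.resolvent_right[OF n])
    also have "\<dots> = form (bracket \<omega> X - l *\<^sub>C X) ?W"
      by (simp add: fr.diff fr.neg fr.scale fl.diff fl.scale form_invariant)
    finally show ?thesis using X(1) by (simp add: ad.shift_def fl.zero)
  qed
  then show False using X(2) form_nondegenerate by blast
qed

text \<open>By invariance the transpose of \<open>z - D\<close> is \<open>z + D = (z + l) + (D - l)\<close>, whose inverse on \<open>X\<close> is the alternating
  Neumann sum.  Its pole is at \<open>- l\<close>.\<close>

lemma form_resolvent: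
  assumes z: "z \<notin> ad.spec" "z \<noteq> - l" and X: "(ad.shift l ^^ n) X = 0"
  shows "form X (res z Y) = form (ad.series n l (alternating_fps (z + l)) X) Y"
proof -
  let ?V = "ad.series n l (alternating_fps (z + l)) X"
  let ?a = "\<lambda>k. ((- 1) ^ k * inverse (z + l) ^ k) *\<^sub>C (ad.shift l ^^ k) X"
  have nz: "z + l \<noteq> 0" using z(2) by (simp add: add_eq_0_iff2)
  have "z *\<^sub>C ?V + bracket \<omega> ?V = (z + l) *\<^sub>C ?V + ad.shift l ?V"
    by (simp add: ad.shift_def algebra_simps)
  also have "\<dots> = (\<Sum>k<n. ((z + l) * ((- 1) ^ k * inverse (z + l) ^ Suc k)) *\<^sub>C (ad.shift l ^^ k) X)
      + (\<Sum>k<n. ((- 1) ^ k * inverse (z + l) ^ Suc k) *\<^sub>C ad.shift l ((ad.shift l ^^ k) X))"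
    by (simp only: ad.series_def alternating_fps_def fps_nth_Abs_fps scale_sum_right ad.shift.sum ad.shift.scale scale_scale)
  also have "\<dots> = (\<Sum>k<n. ?a k - ?a (Suc k))"
  proof -
    have "(z + l) * ((- 1) ^ k * inverse (z + l) ^ Suc k) = (- 1) ^ k * inverse (z + l) ^ k" for k
      using nz by simp
    then show ?thesis unfolding sum.distrib[symmetric] by (intro sum.cong) simp_all
  qed
  also have "\<dots> = ?a 0 - ?a n" by (rule sum_lessThan_telescope')
  finally have V: "z *\<^sub>C ?V + bracket \<omega> ?V = X" using X by simp
  have "form ?V Y = form ?V (z *\<^sub>C res z Y - bracket \<omega> (res z Y))"
    by (simp only: ad.resolvent_right[OF z(1)])
  also have "\<dots> = form (z *\<^sub>C ?V + bracket \<omega> ?V) (res z Y)"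
    by (simp add: fr.diff fr.scale fl.add fl.scale form_invariant)
  finally show ?thesis by (simp only: V)
qed

text \<open>Integrating the transposed resolvent evaluates Taylor coefficients at \<open>- l\<close>; by oddness these are, up to the sign
  \<open>- (- 1)\<^sup>k\<close>, those at \<open>l\<close>.\<close>

lemma antisymmetric: "form (R X) Y = - form X (R Y)"
proof (induction X rule: ad.gen_eig_induct)
  case (gen l n X)
  note l' = spec_uminus[OF gen(1)]
  have np: "l \<notin> coth_poles" "- l \<notin> coth_poles" using ad.poles_dom gen(1) l' by auto
  have h: "(\<lambda>z. inverse (z - - l) ^ Suc k) holomorphic_on - ad.spec" for k
    by (rule ad.holomorphic_pole_power[OF l'])
  have "form X (R Y) = ad.L (\<lambda>z. form X (res z Y))"
    unfolding ad.calc_def by (rule ad.functional_vL[OF form_linear_right ad.vholo_resolvent_vector])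
  also have "\<dots> = ad.L (\<lambda>z. \<Sum>k<n. ((- 1) ^ k * form ((ad.shift l ^^ k) X) Y) * inverse (z - - l) ^ Suc k)"
  proof (rule ad.L_cong)
    fix z assume z: "z \<notin> ad.spec"
    then have "z \<noteq> - l" using l' by auto
    from form_resolvent[OF z this gen(2)] show "form X (res z Y)
        = (\<Sum>k<n. ((- 1) ^ k * form ((ad.shift l ^^ k) X) Y) * inverse (z - - l) ^ Suc k)"
      by (simp only: ad.series_def alternating_fps_def fps_nth_Abs_fps fl.sum fl.scale diff_minus_eq_add mult_ac)
  qed
  also have "\<dots> = (\<Sum>k<n. ((- 1) ^ k * form ((ad.shift l ^^ k) X) Y) * fps_expansion coth_fun (- l) $ k)"
    by (simp only: ad.L_sum ad.L_cmult h holomorphic_on_mult holomorphic_on_const ad.L_power[OF l'])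
  also have "\<dots> = - (\<Sum>k<n. fps_expansion coth_fun l $ k * form ((ad.shift l ^^ k) X) Y)"
    unfolding fps_expansion_coth_fun_uminus[OF np] by (simp add: sum_negf mult_ac)
  also have "\<dots> = - form (R X) Y"
    by (simp add: ad.calc_gen_eig[OF gen] fl.sum fl.scale)
  finally show ?case by simp
qed (auto simp: R.zero R.add R.scale fl.zero fl.add fl.scale)

lemma form_transpose_R: "form_transpose form R = (\<lambda>X. - R X)"
  unfolding form_transpose_def
proof (rule the_equality)
  show "\<forall>X Y. form (- R X) Y = form X (R Y)" by (simp add: fl.neg antisymmetric)
  fix A assume A: "\<forall>X Y. form (A X) Y = form X (R Y)"
  show "A = (\<lambda>X. - R X)"
  proof
    fix X
    have "form (A X + R X) Y = 0" for Y using A antisymmetric[of X Y] by (simp add: fl.add)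
    then have "A X + R X = 0" by (rule form_nondegenerate)
    then show "A X = - R X" by (rule add_eq_0_iff2[THEN iffD1])
  qed
qed

text \<open>On \<open>W = res z X\<close> the operator \<open>ad [S, \<omega>]\<close> gives \<open>(z - D) [S, W] - [S, X]\<close>, and the outer resolvent cancels \<open>z - D\<close>.\<close>

lemma equivariant: "dR (bracket S \<omega>) X = bracket S (R X) - R (bracket S X)"
proof -
  have v: "vholo (- ad.spec) (\<lambda>z. bracket S (res z X))"
    by (intro vholo_operator[OF bracket_linear_right] ad.vholo_resolvent_vector)
  have "res z (bracket (bracket S \<omega>) (res z X)) = bracket S (res z X) - res z (bracket S X)"
    if z: "z \<notin> ad.spec" for z
  proof -
    let ?W = "res z X"
    have "bracket \<omega> ?W = z *\<^sub>C ?W - X" using ad.resolvent_right[OF z, of X] by (simp add: algebra_simps)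
    moreover have "bracket (bracket S \<omega>) ?W = bracket S (bracket \<omega> ?W) - bracket \<omega> (bracket S ?W)"
      using bracket_derivation[of S \<omega> ?W] by simp
    ultimately have "bracket (bracket S \<omega>) ?W
        = (z *\<^sub>C bracket S ?W - bracket \<omega> (bracket S ?W)) - bracket S X"
      by (simp add: br.diff br.scale)
    then show ?thesis
      by (simp only: ad.resolvent_left[OF z]
          ad.resolvent_diff[OF z, of "z *\<^sub>C bracket S ?W - bracket \<omega> (bracket S ?W)"])
  qed
  then have "dR (bracket S \<omega>) X = ad.vL (\<lambda>z. bracket S (res z X) - res z (bracket S X))"
    unfolding dR_def by (rule ad.vL_cong)
  also have "\<dots> = bracket S (R X) - R (bracket S X)"
    unfolding ad.vL_diff[OF v ad.vholo_resolvent_vector] ad.calc_def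
      ad.operator_vL[OF bracket_linear_right ad.vholo_resolvent_vector] ..
  finally show ?thesis .
qed

end

section \<open>The modified classical dynamical Yang-Baxter equation\<close>

lemma alternating_sum_add:
  fixes a b c d e f g :: "'a::ab_group_add"
  shows "(a + a') + (b + b') - ((c + c') + (d + d')) + (e + e') + (f + f') - (g + g')
    = (a + b - (c + d) + e + f - g) + (a' + b' - (c' + d') + e' + f' - g')"
  by (simp only: diff_conv_add_uminus minus_add_distrib add_ac)

context regular_point
begin

text \<open>Transposing the outer resolvent and using invariance once more exhibits the derivative as the pairing of the
  direction \<open>S\<close> with a fixed vector, which is therefore the value of the gradient term.\<close>

lemma gradient_gen_eig:
  assumes l: "l \<in> ad.spec" and X: "(ad.shift l ^^ n) X = 0"
  shows "form X (dR S Y)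
    = form (- ad.vL (\<lambda>z. bracket (ad.series n l (alternating_fps (z - - l)) X) (res z Y))) S"
proof -
  let ?V = "\<lambda>z. ad.series n l (alternating_fps (z - - l)) X"
  note l' = spec_uminus[OF l]
  have V: "vholo (- ad.spec) ?V"
    unfolding ad.series_def by (intro vholo_sum vholo_scale vholo_const ad.alternating_fps_holomorphic[OF l'])
  have VW: "vholo (- ad.spec) (\<lambda>z. bracket (?V z) (res z Y))"
  proof (rule vholo_operator_family[where A="\<lambda>z. bracket (?V z)"])
    show "Vector_Spaces.linear smul smul (bracket (?V z))" for z by (rule bracket_linear_right)
    show "vholo (- ad.spec) (\<lambda>z. bracket (?V z) Z)" for Z by (rule vholo_operator[OF bracket_linear_left V])
  qed (rule ad.vholo_resolvent_vector)
  have "form X (dR S Y) = ad.L (\<lambda>z. form X (res z (bracket S (res z Y))))"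
    unfolding dR_def by (rule ad.functional_vL[OF form_linear_right vholo_dR])
  also have "\<dots> = ad.L (\<lambda>z. form (- bracket (?V z) (res z Y)) S)"
  proof (rule ad.L_cong)
    fix z assume z: "z \<notin> ad.spec"
    then have "z \<noteq> - l" using l' by auto
    then have "form X (res z (bracket S (res z Y))) = form (?V z) (bracket S (res z Y))"
      using form_resolvent[OF z _ X] by simp
    also have "\<dots> = - form (bracket S (?V z)) (res z Y)" by (simp add: form_invariant)
    also have "bracket S (?V z) = - bracket (?V z) S" by (rule bracket_antisym)
    finally show "form X (res z (bracket S (res z Y))) = form (- bracket (?V z) (res z Y)) S"
      using form_invariant[of "?V z" "res z Y" S] by (simp add: fl.neg form_invariant form_sym[of S])
  qed
  also have "\<dots> = ad.L (\<lambda>z. - form (bracket (?V z) (res z Y)) S)" by (simp only: fl.neg)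
  also have "\<dots> = - ad.L (\<lambda>z. form (bracket (?V z) (res z Y)) S)"
    by (rule ad.L_minus) (rule vholo_functional[OF form_linear_left VW])
  also have "\<dots> = form (- ad.vL (\<lambda>z. bracket (?V z) (res z Y))) S"
    by (simp only: fl.neg ad.functional_vL[OF form_linear_left VW])
  finally show ?thesis .
qed

definition gradient :: "'i set \<Rightarrow> ('i \<Rightarrow> 'g) \<Rightarrow> ('i \<Rightarrow> 'g) \<Rightarrow> 'g \<Rightarrow> 'g \<Rightarrow> 'g"
  where "gradient J T T' X Y = (\<Sum>j\<in>J. form X (dR (T j) Y) *\<^sub>C T' j)"

definition dybe :: "'i set \<Rightarrow> ('i \<Rightarrow> 'g) \<Rightarrow> ('i \<Rightarrow> 'g) \<Rightarrow> 'g \<Rightarrow> 'g \<Rightarrow> 'g"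
  where "dybe J T T' X Y = (1/4) *\<^sub>C bracket X Y + bracket (R X) (R Y)
    - R (bracket (R X) Y + bracket X (R Y))
    + gradient J T T' X Y + dR Y X - dR X Y"

lemma
  shows gradient_add_left: "gradient J T T' (X + X') Y = gradient J T T' X Y + gradient J T T' X' Y"
    and gradient_add_right: "gradient J T T' X (Y + Y') = gradient J T T' X Y + gradient J T T' X Y'"
    and gradient_scale_left: "gradient J T T' (c *\<^sub>C X) Y = c *\<^sub>C gradient J T T' X Y"
    and gradient_scale_right: "gradient J T T' X (c *\<^sub>C Y) = c *\<^sub>C gradient J T T' X Y"
  unfolding gradient_def
  by (simp_all only: fl.add fr.add dR.add fl.scale fr.scale dR.scale scale_left_distrib sum.distrib
      scale_sum_right scale_scale)

lemma
  shows dybe_add_left: "dybe J T T' (X + X') Y = dybe J T T' X Y + dybe J T T' X' Y"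
    and dybe_add_right: "dybe J T T' X (Y + Y') = dybe J T T' X Y + dybe J T T' X Y'"
  unfolding dybe_def gradient_add_left gradient_add_right bl.add br.add R.add dR.add dR_direction.add
    scale_right_distrib
  by (rule alternating_sum_add)+

lemma
  shows dybe_scale_left: "dybe J T T' (c *\<^sub>C X) Y = c *\<^sub>C dybe J T T' X Y"
    and dybe_scale_right: "dybe J T T' X (c *\<^sub>C Y) = c *\<^sub>C dybe J T T' X Y"
  unfolding dybe_def gradient_scale_left gradient_scale_right bl.scale br.scale R.scale R.add dR.scale
    dR_direction.scale scale_right_distrib scale_right_diff_distrib scale_left_commute[of "1/4" c]
  by (rule refl)+

lemma
  shows dybe_zero_left: "dybe J T T' 0 Y = 0"
    and dybe_zero_right: "dybe J T T' X 0 = 0"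
  using dybe_scale_left[of J T T' 0 0 Y] dybe_scale_right[of J T T' X 0 0] by simp_all

text \<open>The equation is bilinear in \<open>X\<close> and \<open>Y\<close>, so it suffices to treat generalised eigenvectors.\<close>

context
  fixes l m :: complex and n :: nat and X Y :: 'g and B
  assumes l: "l \<in> ad.spec" and m: "m \<in> ad.spec"
    and B_def: "B = (\<lambda>i j. bracket ((ad.shift l ^^ i) X) ((ad.shift m ^^ j) Y))"
    and X: "(ad.shift l ^^ n) X = 0" and Y: "(ad.shift m ^^ n) Y = 0"
    and B0: "\<And>i j. n \<le> i + j \<Longrightarrow> B i j = 0"
begin

lemma shift_bracket: "ad.shift (l + m) (bracket Z W) = bracket (ad.shift l Z) W + bracket Z (ad.shift m W)"
  by (simp add: ad.shift_def bracket_derivation[of \<omega> Z W] bl.diff br.diff bl.scale br.scale scale_left_distrib)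

lemma shift_B: "ad.shift (l + m) (B i j) = B (Suc i) j + B i (Suc j)"
  by (simp add: B_def shift_bracket)

lemma bracket_series:
  "bracket (ad.series n l u X) (ad.series n m v Y) = (\<Sum>i<n. \<Sum>j<n. (u $ i * v $ j) *\<^sub>C B i j)"
  unfolding ad.series_def B_def bl.sum bl.scale
  by (simp only: br.sum br.scale scale_sum_right scale_scale)

lemma shift_power_bracket_series:
  "(ad.shift (l + m) ^^ n) (bracket (ad.series n l u X) (ad.series n m v Y)) = 0"
proof -
  have "(ad.shift (l + m) ^^ n) (B i j) = 0" for i j
    by (rule funpow_double_sequence_eq_0[where N="ad.shift (l + m)" and B=B and n=n, OF ad.linear_shift shift_B B0]) auto
  then show ?thesis
    unfolding bracket_series by (simp add: ad.shift_power.sum ad.shift_power.scale)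
qed

lemma series_bracket_series:
  "ad.series n (l + m) g (bracket (ad.series n l u X) (ad.series n m v Y))
    = eval2 n B (subst_fps 1 u * subst_fps fps_X v * subst_fps (1 + fps_X) g)"
  unfolding bracket_series ad.series_def[of n "l + m"]
  by (rule eval2_mult_subst[where N="ad.shift (l + m)" and B=B, OF ad.linear_shift shift_B B0, symmetric])

lemma bracket_series_eval2:
  "bracket (ad.series n l u X) (ad.series n m v Y) = eval2 n B (subst_fps 1 u * subst_fps fps_X v)"
  using series_bracket_series[of 1 u v] ad.series_one[OF shift_power_bracket_series]
  by (simp add: subst_fps_one)

lemma R_series: "R X = ad.series n l (fps_expansion coth_fun l) X" "R Y = ad.series n m (fps_expansion coth_fun m) Y"
  by (rule ad.calc_eq_series[OF l X] ad.calc_eq_series[OF m Y])+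

lemma res_series:
  assumes "z \<notin> ad.spec"
  shows "res z X = ad.series n l (geometric_fps (z - l)) X" "res z Y = ad.series n m (geometric_fps (z - m)) Y"
  using ad.resolvent_gen_eig[OF assms l X] ad.resolvent_gen_eig[OF assms m Y]
  by (simp_all only: ad.neumann_eq_series)

lemma gradient_series:
  assumes "dual_bases smul form J T T'"
  shows "gradient J T T' X Y
    = - ad.vL (\<lambda>z. bracket (ad.series n l (alternating_fps (z - - l)) X) (res z Y))"
  unfolding gradient_def gradient_gen_eig[OF l X] by (rule dual_bases_expand[OF assms])

text \<open>All brackets in the equation are generalised eigenvectors for \<open>l + m\<close>.  If this is not an eigenvalue they all
  vanish.  The case has to be separated because \<open>l + m\<close> may then be a pole of \<open>f\<close>, where \<open>f(a + b)\<close> has no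
  meaning.\<close>

lemma dybe_resonance_free:
  assumes "l + m \<notin> ad.spec" and dual: "dual_bases smul form J T T'"
  shows "dybe J T T' X Y = 0"
proof -
  have 0: "bracket (ad.series n l u X) (ad.series n m v Y) = 0" for u v
    using ad.gen_eigenvalue_in_spec[OF shift_power_bracket_series] assms(1) by blast
  have v0: "ad.vL (\<lambda>z. 0) = 0" using ad.vL_scale[of "\<lambda>z. 0" 0] by simp
  have XY: "bracket X (ad.series n m v Y) = 0" "bracket (ad.series n l u X) Y = 0" "bracket X Y = 0" for u v
    using 0[of 1 v] 0[of u 1] 0[of 1 1] by (simp_all only: ad.series_one[OF X] ad.series_one[OF Y])
  have dYX: "dR Y X = 0"
  proof -
    have "bracket Y (res z X) = 0" if "z \<notin> ad.spec" for z
      by (subst bracket_antisym) (simp add: res_series[OF that] XY)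
    then have "dR Y X = ad.vL (\<lambda>z. 0)"
      unfolding dR_def by (intro ad.vL_cong) (simp add: ad.resolvent_zero)
    then show ?thesis by (simp only: v0)
  qed
  have dXY: "dR X Y = 0"
  proof -
    have "dR X Y = ad.vL (\<lambda>z. 0)"
      unfolding dR_def by (intro ad.vL_cong) (simp add: ad.resolvent_zero res_series XY)
    then show ?thesis by (simp only: v0)
  qed
  have "ad.vL (\<lambda>z. bracket (ad.series n l (alternating_fps (z - - l)) X) (res z Y)) = ad.vL (\<lambda>z. 0)"
    by (intro ad.vL_cong) (simp add: res_series 0)
  then have grad: "gradient J T T' X Y = 0"
    unfolding gradient_series[OF dual] v0 by simp
  show ?thesis
    unfolding dybe_def grad dYX dXY by (simp add: R_series 0 XY R.zero)
qed

text \<open>Each term is the evaluation of a formal series in \<open>x\<close>, \<open>y\<close>.  The series \<open>ra\<close>, \<open>rb\<close>, \<open>rc\<close>, \<open>sa\<close> are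
  \<open>1 / (z - a)\<close>, \<open>1 / (z - b)\<close>, \<open>1 / (z - a - b)\<close> and \<open>1 / (z + a)\<close>; integrated against \<open>f\<close>, they become \<open>fa\<close>, \<open>fb\<close>,
  \<open>fc\<close> and, by oddness, \<open>- fa\<close>.  The derivative terms are integrals \<open>g1\<close>, \<open>g2\<close>, \<open>g3\<close> of products of two of them, and the
  resolvent identity for the two factors says that these are the divided differences.\<close>

lemma dybe_resonant:
  assumes p: "l + m \<in> ad.spec" and dual: "dual_bases smul form J T T'"
  shows "dybe J T T' X Y = 0"
proof -
  note l' = spec_uminus[OF l]
  have poles: "l \<notin> coth_poles" "- l \<notin> coth_poles" "m \<notin> coth_poles" "l + m \<notin> coth_poles"
    using l l' m p ad.poles_dom by auto
  define a b where "a = subst_fps 1 (fps_const l + fps_X)" and "b = subst_fps fps_X (fps_const m + fps_X)"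
  define fa fb fc where "fa = subst_fps 1 (fps_expansion coth_fun l)"
    and "fb = subst_fps fps_X (fps_expansion coth_fun m)"
    and "fc = subst_fps (1 + fps_X) (fps_expansion coth_fun (l + m))"
  define ra rb rc sa where "ra z = subst_fps 1 (geometric_fps (z - l))"
    and "rb z = subst_fps fps_X (geometric_fps (z - m))"
    and "rc z = subst_fps (1 + fps_X) (geometric_fps (z - (l + m)))"
    and "sa z = subst_fps 1 (alternating_fps (z - - l))" for z
  define c where "c z = fps_const (fps_const z)" for z :: complex
  have ab: "subst_fps (1 + fps_X) (fps_const (l + m) + fps_X) = a + b"
    by (simp add: a_def b_def subst_fps_add subst_fps_const subst_fps_X algebra_simps
        flip: fps_const_add)
  have holo: "ad.fholo ra" "ad.fholo rb" "ad.fholo rc" "ad.fholo sa"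
    unfolding ra_def rb_def rc_def sa_def
    by (intro ad.fholo_subst ad.geometric_fps_holomorphic ad.alternating_fps_holomorphic l m p l')+
  have geo: "subst_fps w (geometric_fps (z - k)) * (c z - subst_fps w (fps_const k + fps_X)) = 1"
    if "z \<noteq> k" for w z k
  proof -
    have "fps_const (z - k) - fps_X = fps_const z - (fps_const k + fps_X)"
      by (simp flip: fps_const_sub)
    with geometric_fps_inverse[of "z - k"] that
    have "subst_fps w (geometric_fps (z - k) * (fps_const z - (fps_const k + fps_X))) = subst_fps w 1" by simp
    then show ?thesis by (simp only: subst_fps_mult subst_fps_diff subst_fps_const subst_fps_one c_def)
  qed
  have alt: "sa z * (c z + a) = 1" if "z \<noteq> - l" for z
  proof -
    have "fps_const (z - - l) + fps_X = fps_const z + (fps_const l + fps_X)"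
      by (simp flip: fps_const_add)
    moreover have "z - - l \<noteq> 0" using that by (simp add: add_eq_0_iff2)
    ultimately have "subst_fps 1 (alternating_fps (z - - l) * (fps_const z + (fps_const l + fps_X))) = subst_fps 1 1"
      using alternating_fps_inverse by metis
    then show ?thesis
      by (simp only: subst_fps_mult subst_fps_add[of _ "fps_const z"] subst_fps_const subst_fps_one sa_def a_def c_def)
  qed
  have inv: "ra z * (c z - a) = 1" "rb z * (c z - b) = 1" "rc z * (c z - (a + b)) = 1" "sa z * (c z + a) = 1"
    if "z \<notin> ad.spec" for z
    unfolding ra_def rb_def rc_def a_def b_def ab[symmetric, unfolded a_def b_def]
    using that l m p l' by (intro geo alt[unfolded a_def]; auto)+
  have fL: "ad.fL ra = fa" "ad.fL rb = fb" "ad.fL rc = fc"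
    unfolding ra_def rb_def rc_def fa_def fb_def fc_def
    by (rule ad.fL_geometric[OF l] ad.fL_geometric[OF m] ad.fL_geometric[OF p])+
  have fLsa: "ad.fL sa = - fa"
  proof -
    have "Abs_fps (\<lambda>k. (- 1) ^ k * fps_expansion coth_fun (- l) $ k) = - fps_expansion coth_fun l"
      by (rule fps_ext) (simp add: fps_expansion_coth_fun_uminus[OF poles(1,2)])
    then show ?thesis unfolding sa_def fa_def ad.fL_alternating[OF l'] by (simp only: subst_fps_minus)
  qed
  define g1 g2 g3 where "g1 = ad.fL (\<lambda>z. ra z * rc z)" and "g2 = ad.fL (\<lambda>z. rb z * rc z)"
    and "g3 = ad.fL (\<lambda>z. sa z * rb z)"
  have g1: "g1 * b = fc - fa"
  proof -
    have "g1 * b = ad.fL (\<lambda>z. ra z * rc z * b)"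
      unfolding g1_def by (rule ad.fL_mult_const[symmetric]) (intro ad.fholo_mult holo)
    also have "\<dots> = ad.fL (\<lambda>z. rc z - ra z)"
    proof (rule ad.fL_cong)
      fix z assume "z \<notin> ad.spec"
      note inv = inv[OF this]
      have "ra z * rc z * b = ra z * (c z - a) * rc z - rc z * (c z - (a + b)) * ra z" by (simp add: algebra_simps)
      then show "ra z * rc z * b = rc z - ra z" unfolding inv by simp
    qed
    finally show ?thesis by (simp only: ad.fL_diff[OF holo(3,1)] fL)
  qed
  have g2: "g2 * a = fc - fb"
  proof -
    have "g2 * a = ad.fL (\<lambda>z. rb z * rc z * a)"
      unfolding g2_def by (rule ad.fL_mult_const[symmetric]) (intro ad.fholo_mult holo)
    also have "\<dots> = ad.fL (\<lambda>z. rc z - rb z)"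
    proof (rule ad.fL_cong)
      fix z assume "z \<notin> ad.spec"
      note inv = inv[OF this]
      have "rb z * rc z * a = rb z * (c z - b) * rc z - rc z * (c z - (a + b)) * rb z" by (simp add: algebra_simps)
      then show "rb z * rc z * a = rc z - rb z" unfolding inv by simp
    qed
    finally show ?thesis by (simp only: ad.fL_diff[OF holo(3,2)] fL)
  qed
  have g3: "g3 * (a + b) = fa + fb"
  proof -
    have "g3 * (a + b) = ad.fL (\<lambda>z. sa z * rb z * (a + b))"
      unfolding g3_def by (rule ad.fL_mult_const[symmetric]) (intro ad.fholo_mult holo)
    also have "\<dots> = ad.fL (\<lambda>z. rb z - sa z)"
    proof (rule ad.fL_cong)
      fix z assume "z \<notin> ad.spec"
      note inv = inv[OF this]
      have "sa z * rb z * (a + b) = sa z * (c z + a) * rb z - rb z * (c z - b) * sa z" by (simp add: algebra_simps)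
      then show "sa z * rb z * (a + b) = rb z - sa z" unfolding inv by simp
    qed
    finally show ?thesis by (simp add: ad.fL_diff[OF holo(2,4)] fL fLsa)
  qed
  have formal: "1 + 4 * (fa * fb - fc * (fa + fb) - g3 - g1 - g2) = 0"
    using formal_dybe[OF poles(1,3,4)] g1 g2 g3 unfolding a_def b_def fa_def fb_def fc_def by blast

  have bXY: "bracket X Y = eval2 n B 1"
    using bracket_series_eval2[of 1 1] by (simp add: ad.series_one[OF X] ad.series_one[OF Y] subst_fps_one)
  have bRR: "bracket (R X) (R Y) = eval2 n B (fa * fb)"
    unfolding R_series fa_def fb_def by (rule bracket_series_eval2)
  have R_bracket: "R (bracket (ad.series n l u X) (ad.series n m v Y)) = eval2 n B (subst_fps 1 u * subst_fps fps_X v * fc)" for u v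
    unfolding ad.calc_eq_series[OF p shift_power_bracket_series] series_bracket_series fc_def ..
  have RR: "R (bracket (R X) Y + bracket X (R Y)) = eval2 n B (fa * fc) + eval2 n B (fb * fc)"
  proof -
    have "R (bracket (R X) Y) = eval2 n B (fa * fc)"
      using R_bracket[of "fps_expansion coth_fun l" 1]
      by (simp add: ad.series_one[OF Y] R_series(1)[symmetric] subst_fps_one fa_def)
    moreover have "R (bracket X (R Y)) = eval2 n B (fb * fc)"
      using R_bracket[of 1 "fps_expansion coth_fun m"]
      by (simp add: ad.series_one[OF X] R_series(2)[symmetric] subst_fps_one fb_def)
    ultimately show ?thesis by (simp only: R.add)
  qed
  have res_bracket: "res z (bracket (ad.series n l u X) (ad.series n m v Y))
      = eval2 n B (subst_fps 1 u * subst_fps fps_X v * rc z)" if "z \<notin> ad.spec" for u v z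
    unfolding ad.resolvent_gen_eig[OF that p shift_power_bracket_series] ad.neumann_eq_series
      series_bracket_series rc_def ..
  have dYX: "dR Y X = - eval2 n B g1"
  proof -
    have "dR Y X = ad.vL (\<lambda>z. - eval2 n B (ra z * rc z))"
      unfolding dR_def
    proof (rule ad.vL_cong)
      fix z assume z: "z \<notin> ad.spec"
      have "res z (bracket Y (res z X)) = - res z (bracket (res z X) Y)"
        by (subst bracket_antisym) (use ad.resolvent_scale[OF z, of "-1"] in simp)
      also have "res z (bracket (res z X) Y) = eval2 n B (ra z * rc z)"
        using res_bracket[OF z, of "geometric_fps (z - l)" 1]
        by (simp add: ad.series_one[OF Y] res_series(1)[OF z, symmetric] subst_fps_one ra_def)
      finally show "res z (bracket Y (res z X)) = - eval2 n B (ra z * rc z)" .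
    qed
    also have "\<dots> = - eval2 n B g1"
      unfolding g1_def
      by (simp only: ad.vL_minus[OF ad.vholo_eval2] ad.vL_eval2 ad.fholo_mult holo)
    finally show ?thesis .
  qed
  have dXY: "dR X Y = eval2 n B g2"
  proof -
    have "dR X Y = ad.vL (\<lambda>z. eval2 n B (rb z * rc z))"
      unfolding dR_def
    proof (rule ad.vL_cong)
      fix z assume z: "z \<notin> ad.spec"
      show "res z (bracket X (res z Y)) = eval2 n B (rb z * rc z)"
        using res_bracket[OF z, of 1 "geometric_fps (z - m)"]
        by (simp add: ad.series_one[OF X] res_series(2)[OF z, symmetric] subst_fps_one rb_def)
    qed
    then show ?thesis
      unfolding g2_def by (simp only: ad.vL_eval2 ad.fholo_mult holo)
  qed
  have grad: "gradient J T T' X Y = - eval2 n B g3"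
  proof -
    have "ad.vL (\<lambda>z. bracket (ad.series n l (alternating_fps (z - - l)) X) (res z Y))
        = ad.vL (\<lambda>z. eval2 n B (sa z * rb z))"
      by (rule ad.vL_cong) (simp add: res_series(2) bracket_series_eval2 sa_def rb_def)
    then show ?thesis
      unfolding gradient_series[OF dual] g3_def by (simp only: ad.vL_eval2 ad.fholo_mult holo)
  qed
  have "4 *\<^sub>C dybe J T T' X Y
      = eval2 n B 1 + 4 *\<^sub>C eval2 n B (fa * fb - fc * (fa + fb) - g3 - g1 - g2)"
    unfolding dybe_def bXY bRR RR dYX dXY grad
    by (simp add: eval2_add eval2_diff scale_right_distrib scale_right_diff_distrib algebra_simps)
  also have "\<dots> = eval2 n B (1 + 4 * (fa * fb - fc * (fa + fb) - g3 - g1 - g2))"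
    by (simp only: eval2_add flip: eval2_scale numeral_fps_const)
  also have "\<dots> = 0" unfolding formal using eval2_scale[of n B 0 0] by simp
  finally show ?thesis by simp
qed

end

lemma dybe_eq_0:
  assumes dual: "dual_bases smul form J T T'"
  shows "dybe J T T' X Y = 0"
proof (induction X rule: ad.gen_eig_induct)
  case (gen l n1 X)
  show ?case
  proof (induction Y rule: ad.gen_eig_induct)
    case (gen m n2 Y)
    \<comment> \<open>if \<open>n1 + n2 \<le> i + j\<close>, then \<open>n1 \<le> i\<close> or \<open>n2 \<le> j\<close>, and one entry of the bracket vanishes\<close>
    let ?n = "n1 + n2"
    have X: "(ad.shift l ^^ k) X = 0" if "n1 \<le> k" for k
      using ad.shift_power_zero_mono[OF \<open>(ad.shift l ^^ n1) X = 0\<close> that] .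
    have Y: "(ad.shift m ^^ k) Y = 0" if "n2 \<le> k" for k
      using ad.shift_power_zero_mono[OF gen(2) that] .
    have B0: "bracket ((ad.shift l ^^ i) X) ((ad.shift m ^^ j) Y) = 0" if "?n \<le> i + j" for i j
      using X[of i] Y[of j] that by (cases "n1 \<le> i") (auto simp: bl.zero br.zero)
    show ?case
      using dybe_resonant[OF \<open>l \<in> ad.spec\<close> gen(1) refl X[of ?n] Y[of ?n] B0 _ dual]
        dybe_resonance_free[OF \<open>l \<in> ad.spec\<close> gen(1) refl X[of ?n] Y[of ?n] B0 _ dual]
      by auto
  qed (simp_all add: dybe_zero_right dybe_add_right dybe_scale_right)
qed (simp_all add: dybe_zero_left dybe_add_left dybe_scale_left)

end

theorem theorem1:
  fixes smul :: "complex \<Rightarrow> 'g \<Rightarrow> 'g::ab_group_add" (infixr "*\<^sub>C" 75)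
    and E :: "'g set"
    and bracket :: "'g \<Rightarrow> 'g \<Rightarrow> 'g"
    and form :: "'g \<Rightarrow> 'g \<Rightarrow> complex"
    and G' :: "'g set"
    and R :: "'g \<Rightarrow> 'g \<Rightarrow> 'g"
    and nabla :: "'g \<Rightarrow> 'g \<Rightarrow> 'g \<Rightarrow> 'g"
  assumes "metric_lie_algebra smul E bracket form"
    and G'_def: "G' = regular_set smul bracket"
    and R_def: "R = r_matrix smul E bracket"
    and nabla_def: "nabla = dir_deriv smul E R"
  shows
    "(\<forall>\<omega>\<in>G'. r_matrix_well_defined smul E bracket \<omega>) \<and>
     (\<forall>\<omega>\<in>G'. \<forall>S. has_dir_deriv smul E R S \<omega> (nabla S \<omega>)) \<and>
     (\<forall>\<omega>\<in>G'. form_transpose form (R \<omega>) = (\<lambda>X. - R \<omega> X)) \<and>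
     (\<forall>S. \<forall>\<omega>\<in>G'. nabla (bracket S \<omega>) \<omega> = commutator (bracket S) (R \<omega>)) \<and>
     (\<forall>(J :: 'i set) T T'. dual_bases smul form J T T' \<longrightarrow>
       (\<forall>X Y. \<forall>\<omega>\<in>G'.
          (1/4) *\<^sub>C bracket X Y + bracket (R \<omega> X) (R \<omega> Y)
          - R \<omega> (bracket (R \<omega> X) Y + bracket X (R \<omega> Y))
          + gradient_term smul E form J T T' R \<omega> X Y
          + nabla Y \<omega> X - nabla X \<omega> Y = 0))"
proof -
  have rp: "regular_point smul E bracket form \<omega>" if "\<omega> \<in> G'" for \<omega>
    using assms(1) that unfolding G'_def
    by (intro regular_point.intro regular_point_axioms.intro)
  show ?thesis
  proof (intro conjI ballI allI impI)
    fix \<omega> assume "\<omega> \<in> G'"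
    then interpret regular_point smul E bracket form \<omega> by (rule rp)
    have R: "R \<omega> = ad.calc" unfolding R_def by (rule r_matrix_eq)
    have nabla: "nabla S \<omega> = dR S" for S unfolding nabla_def R_def by (rule dir_deriv_eq)
    show "r_matrix_well_defined smul E bracket \<omega>" by (rule well_defined)
    show "has_dir_deriv smul E R S \<omega> (nabla S \<omega>)" for S
      unfolding nabla R_def by (rule has_dir_deriv_dR)
    show "form_transpose form (R \<omega>) = (\<lambda>X. - R \<omega> X)"
      unfolding R by (rule form_transpose_R)
    show "nabla (bracket S \<omega>) \<omega> = commutator (bracket S) (R \<omega>)" for S
      unfolding R nabla commutator_def by (rule ext) (rule equivariant)
    fix J :: "'i set" and T T' X Y
    assume "dual_bases smul form J T T'"
    from dybe_eq_0[OF this, of X Y]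
    show "(1/4) *\<^sub>C bracket X Y + bracket (R \<omega> X) (R \<omega> Y)
          - R \<omega> (bracket (R \<omega> X) Y + bracket X (R \<omega> Y))
          + gradient_term smul E form J T T' R \<omega> X Y
          + nabla Y \<omega> X - nabla X \<omega> Y = 0"
      unfolding dybe_def gradient_def gradient_term_def nabla_def[symmetric] R nabla .
  qed
qed

end
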